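(* Let $q$ be a nonzero complex number, let $n\ge 1$ and $0\le r\le n$ be integers, and consider the quantum matrix algebra $M_q(2n)$ with its quantum minors $\xi^I_J$. Then $$\sum_{\sigma}(-q)^{l(\sigma)}\,\xi^{n+1,\dots,2n}_{i_1,\dots,i_n}\,\xi^{1,\dots,n}_{i_{n+1},\dots,i_{2n}}=(-q)^{n^2-2nr}\sum_{\sigma}(-q)^{n^2-l(\sigma)}\,\xi^{1,\dots,n}_{i_{n+1},\dots,i_{2n}}\,\xi^{n+1,\dots,2n}_{i_1,\dots,i_n},$$ where both sums run over all permutations $\sigma=\begin{pmatrix}1&2&\cdots&2n\\ i_1&i_2&\cdots&i_{2n}\end{pmatrix}\in S_{2n}$ such that $i_k=k$ for $1\le k\le r$, $i_{r+1}<i_{r+2}<\cdots<i_n$, and $i_{n+1}<i_{n+2}<\cdots<i_{2n}$.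
   Context: $M_q(N)$ is the unital associative complex algebra generated by $a_{ij}$, $1\le i,j\le N$, subject to the relations, for all $i<j$ and $k<l$: $a_{ik}a_{il}=qa_{il}a_{ik}$, $a_{ik}a_{jk}=qa_{jk}a_{ik}$, $a_{jk}a_{il}=a_{il}a_{jk}$, $a_{ik}a_{jl}-a_{jl}a_{ik}=(q-q^{-1})a_{il}a_{jk}$. For $i_1<\cdots<i_s$ and $j_1<\cdots<j_s$ in $\{1,\dots,N\}$ the quantum minor (rows on top, columns below) is $\xi^{i_1,\dots,i_s}_{j_1,\dots,j_s}=\sum_{\sigma\in S_s}(-q)^{l(\sigma)}a_{i_1,j_{\sigma(1)}}\cdots a_{i_s,j_{\sigma(s)}}$. Here $l(\sigma)$ denotes the number of inversions of the permutation $\sigma$. *)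

theory Defs
  imports
    "HOL-Algebra.QuotRing"
    "HOL-Algebra.Module"
    "HOL-Algebra.Algebraic_Closure_Type"
    "HOL-Combinatorics.Permutations"
    "HOL-Library.Poly_Mapping"
begin

section \<open>The free algebra\<close>

text \<open>
  Words are wrapped in a type of their own because the product of HOL-Library.Poly_Mapping is
  convolution with respect to addition on the index type; \<open>+\<close> is concatenation. Thus
  \<open>'g fword \<Rightarrow>\<^sub>0 complex\<close> is the free unital associative complex algebra on \<open>'g\<close>.
\<close>

datatype 'g fword = FWord (letters: "'g list")

instantiation fword :: (type) monoid_add
begin

definition zero_fword :: "'g fword" where
  "zero_fword = FWord []"

definition plus_fword :: "'g fword \<Rightarrow> 'g fword \<Rightarrow> 'g fword" where
  "plus_fword u v = FWord (letters u @ letters v)"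

instance
  by standard (simp_all add: zero_fword_def plus_fword_def)

end

type_synonym 'g free = "'g fword \<Rightarrow>\<^sub>0 complex"

definition free_gen :: "'g \<Rightarrow> 'g free" where
  "free_gen x = Poly_Mapping.single (FWord [x]) 1"

definition free_scalar :: "complex \<Rightarrow> 'g free" where
  "free_scalar c = Poly_Mapping.single 0 c"

definition free_algebra :: "'g set \<Rightarrow> 'g free ring" where
  "free_algebra G =
     \<lparr>carrier = {f. \<forall>w\<in>Poly_Mapping.keys f. set (letters w) \<subseteq> G},
      monoid.mult = (\<lambda>f g. f * g), one = 1, ring.zero = 0, add = (\<lambda>f g. f + g)\<rparr>"

section \<open>The quantum matrix algebra\<close>

text \<open>
  Each of the four families is imposed for all indices that occur in it: the first for every row
  \<open>i\<close>, the second for every column \<open>k\<close>.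
\<close>

definition qmat_relations :: "complex \<Rightarrow> nat \<Rightarrow> (nat \<times> nat) free set" where
  "qmat_relations q N = (let a = (\<lambda>i j. free_gen (i, j)) in
     {a i k * a i l - free_scalar q * a i l * a i k | i k l.
        i \<in> {1..N} \<and> k \<in> {1..N} \<and> l \<in> {1..N} \<and> k < l} \<union>
     {a i k * a j k - free_scalar q * a j k * a i k | i j k.
        i \<in> {1..N} \<and> j \<in> {1..N} \<and> k \<in> {1..N} \<and> i < j} \<union>
     {a j k * a i l - a i l * a j k | i j k l.
        i \<in> {1..N} \<and> j \<in> {1..N} \<and> k \<in> {1..N} \<and> l \<in> {1..N} \<and> i < j \<and> k < l} \<union>
     {a i k * a j l - a j l * a i k - free_scalar (q - inverse q) * a i l * a j k | i j k l.
        i \<in> {1..N} \<and> j \<in> {1..N} \<and> k \<in> {1..N} \<and> l \<in> {1..N} \<and> i < j \<and> k < l})"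

abbreviation qmat_free :: "nat \<Rightarrow> (nat \<times> nat) free ring" where
  "qmat_free N \<equiv> free_algebra ({1..N} \<times> {1..N})"

text \<open>Ideals of HOL-Algebra are two-sided.\<close>

definition qmat_ideal :: "complex \<Rightarrow> nat \<Rightarrow> (nat \<times> nat) free set" where
  "qmat_ideal q N = Idl\<^bsub>qmat_free N\<^esub> (qmat_relations q N)"

definition qmat_class :: "complex \<Rightarrow> nat \<Rightarrow> (nat \<times> nat) free \<Rightarrow> (nat \<times> nat) free set" where
  "qmat_class q N f = qmat_ideal q N +>\<^bsub>qmat_free N\<^esub> f"

definition qmat_algebra :: "complex \<Rightarrow> nat \<Rightarrow> (complex, (nat \<times> nat) free set) module" where
  "qmat_algebra q N = (let Q = qmat_free N Quot qmat_ideal q N in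
     ring.extend Q (module.fields (\<lambda>c x. qmat_class q N (free_scalar c) \<otimes>\<^bsub>Q\<^esub> x)))"

definition qmat_gen :: "complex \<Rightarrow> nat \<Rightarrow> nat \<Rightarrow> nat \<Rightarrow> (nat \<times> nat) free set" where
  "qmat_gen q N i j = qmat_class q N (free_gen (i, j))"

section \<open>Quantum minors\<close>

definition inversion_number :: "nat set \<Rightarrow> (nat \<Rightarrow> nat) \<Rightarrow> nat" where
  "inversion_number A \<sigma> = card {(i, j). i \<in> A \<and> j \<in> A \<and> i < j \<and> \<sigma> j < \<sigma> i}"

text \<open>
  Rows and columns are given as increasing lists of the same length; list positions, and hence
  the permutations in the sum, are counted from 0. The factors of the product are noncommuting
  and taken in the order of the rows.
\<close>

definition quantum_minor ::
    "complex \<Rightarrow> nat \<Rightarrow> nat list \<Rightarrow> nat list \<Rightarrow> (nat \<times> nat) free set" where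
  "quantum_minor q N rows cols =
     (\<Oplus>\<^bsub>qmat_algebra q N\<^esub>\<sigma>\<in>{\<sigma>. \<sigma> permutes {..<length rows}}.
        (-q) ^ inversion_number {..<length rows} \<sigma> \<odot>\<^bsub>qmat_algebra q N\<^esub>
        foldr (\<lambda>x y. x \<otimes>\<^bsub>qmat_algebra q N\<^esub> y)
          (map (\<lambda>k. qmat_gen q N (rows ! k) (cols ! \<sigma> k)) [0..<length rows])
          \<one>\<^bsub>qmat_algebra q N\<^esub>)"

section \<open>The permutations in the Laplace-type sums\<close>

definition fixing_shuffles :: "nat \<Rightarrow> nat \<Rightarrow> (nat \<Rightarrow> nat) set" where
  "fixing_shuffles n r =
     {\<sigma>. \<sigma> permutes {1..2*n} \<and> (\<forall>k\<in>{1..r}. \<sigma> k = k) \<and>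
         strict_mono_on {r+1..n} \<sigma> \<and> strict_mono_on {n+1..2*n} \<sigma>}"

section \<open>Basic facts\<close>

lemma qmat_algebra_simps:
  "carrier (qmat_algebra q N) = carrier (qmat_free N Quot qmat_ideal q N)"
  "monoid.mult (qmat_algebra q N) = monoid.mult (qmat_free N Quot qmat_ideal q N)"
  "one (qmat_algebra q N) = one (qmat_free N Quot qmat_ideal q N)"
  "ring.zero (qmat_algebra q N) = ring.zero (qmat_free N Quot qmat_ideal q N)"
  "add (qmat_algebra q N) = add (qmat_free N Quot qmat_ideal q N)"
  "c \<odot>\<^bsub>qmat_algebra q N\<^esub> x =
     qmat_class q N (free_scalar c) \<otimes>\<^bsub>qmat_free N Quot qmat_ideal q N\<^esub> x"
  by (simp_all add: qmat_algebra_def Let_def ring.defs module.defs)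

lemma letters_plus: "letters (u + v) = letters u @ letters v"
  by (simp add: plus_fword_def)

lemma ring_free_algebra: "ring (free_algebra G)"
proof -
  have mult_closed: "f * g \<in> carrier (free_algebra G)"
    if "f \<in> carrier (free_algebra G)" "g \<in> carrier (free_algebra G)" for f g
    using that keys_mult[of f g] by (fastforce simp: free_algebra_def letters_plus)
  have add_closed: "f + g \<in> carrier (free_algebra G)"
    if "f \<in> carrier (free_algebra G)" "g \<in> carrier (free_algebra G)" for f g
    using that Poly_Mapping.keys_add[of f g] by (fastforce simp: free_algebra_def)
  have minus_closed: "- f \<in> carrier (free_algebra G)" if "f \<in> carrier (free_algebra G)" for f
    using that by (simp add: free_algebra_def)
  have one_closed: "1 \<in> carrier (free_algebra G)"
    by (simp add: free_algebra_def zero_fword_def)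
  have zero_closed: "0 \<in> carrier (free_algebra G)"
    by (simp add: free_algebra_def)
  have ops: "f \<otimes>\<^bsub>free_algebra G\<^esub> g = f * g" "f \<oplus>\<^bsub>free_algebra G\<^esub> g = f + g"
    "\<one>\<^bsub>free_algebra G\<^esub> = 1" "\<zero>\<^bsub>free_algebra G\<^esub> = 0" for f g
    by (simp_all add: free_algebra_def)
  show ?thesis
  proof (rule ringI)
    show "abelian_group (free_algebra G)"
    proof (rule abelian_groupI)
      fix f assume "f \<in> carrier (free_algebra G)"
      then show "\<exists>g\<in>carrier (free_algebra G). g \<oplus>\<^bsub>free_algebra G\<^esub> f = \<zero>\<^bsub>free_algebra G\<^esub>"
        using minus_closed by (intro bexI[of _ "- f"]) (simp_all add: ops)
    qed (simp_all add: ops add_closed zero_closed ac_simps)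
    show "monoid (free_algebra G)"
      by (rule monoidI) (simp_all add: ops mult_closed one_closed mult.assoc)
  qed (simp_all add: ops distrib_left distrib_right)
qed

lemma ideal_qmat_ideal: "ideal (qmat_ideal q N) (qmat_free N)"
proof -
  interpret F: ring "qmat_free N" by (rule ring_free_algebra)
  have gen: "free_gen (i, j) \<in> carrier (qmat_free N)" if "i \<in> {1..N}" "j \<in> {1..N}" for i j
    using that by (simp add: free_algebra_def free_gen_def)
  have scal: "free_scalar c \<in> carrier (qmat_free N)" for c
    by (simp add: free_algebra_def free_scalar_def zero_fword_def)
  have mult: "f * g \<in> carrier (qmat_free N)"
    if "f \<in> carrier (qmat_free N)" "g \<in> carrier (qmat_free N)" for f g
    using F.m_closed[OF that] by (simp add: free_algebra_def)
  have diff: "f - g \<in> carrier (qmat_free N)"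
    if "f \<in> carrier (qmat_free N)" "g \<in> carrier (qmat_free N)" for f g
    using that keys_diff[of f g] by (fastforce simp: free_algebra_def)
  have "qmat_relations q N \<subseteq> carrier (qmat_free N)"
    unfolding qmat_relations_def Let_def
    by (intro Un_least subsetI; elim CollectE exE conjE; hypsubst)
      (intro diff mult gen scal; assumption)+
  then show ?thesis
    unfolding qmat_ideal_def by (rule F.genideal_ideal)
qed

lemma ring_qmat_algebra: "ring (qmat_algebra q N)"
proof -
  define Q where "Q = qmat_free N Quot qmat_ideal q N"
  interpret Q: ring Q
    unfolding Q_def by (rule ideal.quotient_is_ring[OF ideal_qmat_ideal])
  note ops = qmat_algebra_simps(1-5)[of q N, folded Q_def]
  show ?thesis
  proof (rule ringI)
    show "abelian_group (qmat_algebra q N)"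
    proof (rule abelian_groupI)
      fix x assume "x \<in> carrier (qmat_algebra q N)"
      then show "\<exists>y\<in>carrier (qmat_algebra q N).
          y \<oplus>\<^bsub>qmat_algebra q N\<^esub> x = \<zero>\<^bsub>qmat_algebra q N\<^esub>"
        unfolding ops using Q.a_inv_closed Q.l_neg by blast
    qed (simp_all add: ops Q.a_ac)
    show "monoid (qmat_algebra q N)"
      by (rule monoidI) (simp_all add: ops Q.m_assoc)
  qed (simp_all add: ops Q.l_distr Q.r_distr)
qed

lemma free_scalar_commute: "free_scalar c * f = f * free_scalar c"
proof (induction f rule: update_induct)
  case const
  show ?case by simp
next
  case (update f k v)
  have "Poly_Mapping.update k v f = f + Poly_Mapping.single k v"
    using update.hyps
    by (intro poly_mapping_eqI) (auto simp: lookup_update lookup_add lookup_single in_keys_iff when_def)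
  moreover have "free_scalar c * Poly_Mapping.single k v = Poly_Mapping.single k v * free_scalar c"
    by (simp add: free_scalar_def mult_single mult.commute)
  ultimately show ?case
    using update.IH by (simp add: distrib_left distrib_right)
qed

lemma qmat_class_hom: "qmat_class q N \<in> ring_hom (qmat_free N) (qmat_algebra q N)"
proof -
  interpret I: ideal "qmat_ideal q N" "qmat_free N" by (rule ideal_qmat_ideal)
  have "(\<lambda>f. qmat_class q N f) \<in> ring_hom (qmat_free N) (qmat_free N Quot qmat_ideal q N)"
    unfolding qmat_class_def by (rule I.rcos_ring_hom)
  then show ?thesis
    by (simp add: ring_hom_def qmat_algebra_simps)
qed

lemma free_scalar_closed: "free_scalar c \<in> carrier (free_algebra G)"
  by (simp add: free_algebra_def free_scalar_def zero_fword_def)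

lemma module_qmat_algebra:
  "module (ring_of_type_algebra :: complex ring) (qmat_algebra q N)"
proof -
  let ?A = "qmat_algebra q N" and ?s = "\<lambda>c. qmat_class q N (free_scalar c)"
  interpret A: ring ?A by (rule ring_qmat_algebra)
  have smult: "c \<odot>\<^bsub>?A\<^esub> x = ?s c \<otimes>\<^bsub>?A\<^esub> x" for c x
    by (simp add: qmat_algebra_simps)
  have closed: "?s c \<in> carrier ?A" for c
    by (rule ring_hom_closed[OF qmat_class_hom free_scalar_closed])
  have add: "?s (c + d) = ?s c \<oplus>\<^bsub>?A\<^esub> ?s d" for c d
    unfolding ring_hom_add[OF qmat_class_hom free_scalar_closed free_scalar_closed, symmetric]
    by (simp add: free_algebra_def free_scalar_def single_add)
  have mult: "?s (c * d) = ?s c \<otimes>\<^bsub>?A\<^esub> ?s d" for c d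
    unfolding ring_hom_mult[OF qmat_class_hom free_scalar_closed free_scalar_closed, symmetric]
    by (simp add: free_algebra_def free_scalar_def mult_single)
  have one: "?s 1 = \<one>\<^bsub>?A\<^esub>"
    unfolding ring_hom_one[OF qmat_class_hom, symmetric]
    by (simp add: free_algebra_def free_scalar_def)
  have R: "a \<oplus>\<^bsub>ring_of_type_algebra\<^esub> b = a + b" "a \<otimes>\<^bsub>ring_of_type_algebra\<^esub> b = a * b"
    "\<one>\<^bsub>ring_of_type_algebra\<^esub> = (1 :: complex)" for a b :: complex
    by (simp_all add: ring_of_type_algebra_def)
  show ?thesis
    by (rule moduleI)
      (simp_all add: cring_from_type_algebra A.abelian_group_axioms R smult closed add mult one
        A.l_distr A.r_distr A.m_assoc)
qed

lemma qmat_smult_assoc: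
  assumes "x \<in> carrier (qmat_algebra q N)" "y \<in> carrier (qmat_algebra q N)"
  shows "(c \<odot>\<^bsub>qmat_algebra q N\<^esub> x) \<otimes>\<^bsub>qmat_algebra q N\<^esub> y =
      c \<odot>\<^bsub>qmat_algebra q N\<^esub> (x \<otimes>\<^bsub>qmat_algebra q N\<^esub> y)"
    and "x \<otimes>\<^bsub>qmat_algebra q N\<^esub> (c \<odot>\<^bsub>qmat_algebra q N\<^esub> y) =
      c \<odot>\<^bsub>qmat_algebra q N\<^esub> (x \<otimes>\<^bsub>qmat_algebra q N\<^esub> y)"
proof -
  let ?A = "qmat_algebra q N" and ?s = "qmat_class q N (free_scalar c)"
  interpret A: ring ?A by (rule ring_qmat_algebra)
  have smult: "c \<odot>\<^bsub>?A\<^esub> x = ?s \<otimes>\<^bsub>?A\<^esub> x" for x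
    by (simp add: qmat_algebra_simps)
  have closed: "?s \<in> carrier ?A"
    by (rule ring_hom_closed[OF qmat_class_hom free_scalar_closed])
  obtain f where f: "f \<in> carrier (qmat_free N)" "x = qmat_class q N f"
    using assms(1) unfolding qmat_algebra_simps FactRing_def A_RCOSETS_def' qmat_class_def
      partial_object.simps by blast
  have "free_scalar c \<otimes>\<^bsub>qmat_free N\<^esub> f = f \<otimes>\<^bsub>qmat_free N\<^esub> free_scalar c"
    by (simp add: free_algebra_def free_scalar_commute)
  then have comm: "?s \<otimes>\<^bsub>?A\<^esub> x = x \<otimes>\<^bsub>?A\<^esub> ?s"
    using ring_hom_mult[OF qmat_class_hom free_scalar_closed f(1)]
      ring_hom_mult[OF qmat_class_hom f(1) free_scalar_closed] f(2) by metis
  show "(c \<odot>\<^bsub>?A\<^esub> x) \<otimes>\<^bsub>?A\<^esub> y = c \<odot>\<^bsub>?A\<^esub> (x \<otimes>\<^bsub>?A\<^esub> y)"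
    using assms closed by (simp add: smult A.m_assoc)
  show "x \<otimes>\<^bsub>?A\<^esub> (c \<odot>\<^bsub>?A\<^esub> y) = c \<odot>\<^bsub>?A\<^esub> (x \<otimes>\<^bsub>?A\<^esub> y)"
    unfolding smult using assms closed comm by (metis A.m_assoc)
qed

end

theory Submission
  imports Defs "HOL-Combinatorics.Multiset_Permutations"
begin

text \<open>
  Let \<open>D(B, C)\<close> be the row-ordered quantum determinant of a list \<open>B\<close> of rows, not necessarily
  increasing, and a set \<open>C\<close> of columns. Interchanging two adjacent rows \<open>x > y\<close> multiplies it by
  \<open>-q\<close>, so moving a block \<open>B\<close> past a block \<open>T\<close> of smaller rows costs \<open>(-q)\<close> to the power
  \<open>|B| |T|\<close>; together with Laplace expansion along rows this is the case \<open>r = 0\<close>. For larger \<open>r\<close>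
  induct on the number of fixed columns: expand the minors with the larger rows along their first
  column. The coefficients that split off have a larger row and a smaller column than every
  generator in the other minor, hence they commute with it, and the remaining sum is an instance
  of the induction hypothesis. All of this is done in the free algebra modulo the defining ideal.
\<close>

section \<open>Inversions between sets of columns\<close>

definition pos_in :: "nat set \<Rightarrow> nat \<Rightarrow> nat" where
  "pos_in C c = card {x\<in>C. x < c}"

definition inversions_between :: "nat set \<Rightarrow> nat set \<Rightarrow> nat" where
  "inversions_between I J = card {(i, j). i \<in> I \<and> j \<in> J \<and> j < i}"

lemma inversions_between_altdef:
  assumes "finite I" "finite J"
  shows "inversions_between I J = (\<Sum>i\<in>I. pos_in J i)"
proof -
  have "{(i, j). i \<in> I \<and> j \<in> J \<and> j < i} = (SIGMA i:I. {j\<in>J. j < i})"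
    by auto
  then show ?thesis
    using assms by (simp add: inversions_between_def pos_in_def)
qed

lemma inversions_between_empty [simp]:
  "inversions_between {} J = 0" "inversions_between I {} = 0"
  by (simp_all add: inversions_between_def)

lemma inversions_between_insert:
  assumes "finite I" "finite J" "c \<notin> I"
  shows "inversions_between (insert c I) J = pos_in J c + inversions_between I J"
  using assms by (simp add: inversions_between_altdef)

lemma pos_in_insert_below: "finite C \<Longrightarrow> x \<notin> C \<Longrightarrow> x < c \<Longrightarrow> pos_in (insert x C) c = Suc (pos_in C c)"
proof -
  assume "finite C" "x \<notin> C" "x < c"
  moreover from this have "{y \<in> insert x C. y < c} = insert x {y \<in> C. y < c}" by auto
  ultimately show ?thesis by (simp add: pos_in_def)
qed

lemma pos_in_insert_above: "c \<le> x \<Longrightarrow> pos_in (insert x C) c = pos_in C c"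
  unfolding pos_in_def by (rule arg_cong[of _ _ card]) auto

lemma pos_in_Un_disjoint:
  "finite A \<Longrightarrow> finite B \<Longrightarrow> A \<inter> B = {} \<Longrightarrow> pos_in (A \<union> B) c = pos_in A c + pos_in B c"
  unfolding pos_in_def by (subst card_Un_disjoint[symmetric]) (auto intro!: arg_cong[of _ _ card])

lemma pos_in_eq_0: "(\<And>x. x \<in> C \<Longrightarrow> c \<le> x) \<Longrightarrow> pos_in C c = 0"
  unfolding pos_in_def by (subst card_eq_0_iff) (auto simp: not_less[symmetric])

text \<open>The defining relations mix the two orders of a pair of columns, so the terms for (c, d)
  and (d, c) have to be grouped before the relations can be applied.\<close>

lemma sum_off_diagonal:
  fixes f :: "nat \<Rightarrow> nat \<Rightarrow> 'a::comm_monoid_add"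
  assumes "finite C"
  shows "(\<Sum>c\<in>C. \<Sum>d\<in>C - {c}. f c d) = (\<Sum>c\<in>C. \<Sum>d\<in>{d\<in>C. c < d}. f c d + f d c)"
proof -
  have split: "(\<Sum>d\<in>C - {c}. f c d) = (\<Sum>d\<in>{d\<in>C. c < d}. f c d) + (\<Sum>d\<in>{d\<in>C. d < c}. f c d)" for c
  proof -
    have "C - {c} = {d\<in>C. c < d} \<union> {d\<in>C. d < c}" by auto
    moreover have "{d\<in>C. c < d} \<inter> {d\<in>C. d < c} = {}" by auto
    ultimately show ?thesis using assms by (simp add: sum.union_disjoint)
  qed
  have swap: "(\<Sum>c\<in>C. \<Sum>d\<in>{d\<in>C. d < c}. f c d) = (\<Sum>c\<in>C. \<Sum>d\<in>{d\<in>C. c < d}. f d c)"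
    using assms by (rule sum.swap_restrict[OF _ assms, of _ "\<lambda>c d. f c d" "\<lambda>c d. d < c"])
  show ?thesis
    by (simp add: split sum.distrib swap)
qed

section \<open>Scalars and operations of the free algebra\<close>

lemma free_scalar_one: "free_scalar 1 = 1"
  by (simp add: free_scalar_def)

lemma free_scalar_add: "free_scalar c + free_scalar d = free_scalar (c + d)"
  by (simp add: free_scalar_def single_add)

lemma free_scalar_mult:
  "free_scalar c * free_scalar d = free_scalar (c * d)"
  "free_scalar c * (free_scalar d * x) = free_scalar (c * d) * x"
  by (simp_all add: free_scalar_def mult_single mult.assoc[symmetric])

lemma mult_free_scalar: "x * (free_scalar c * y) = free_scalar c * (x * y)"
  by (simp only: mult.assoc[symmetric] free_scalar_commute[of c x, symmetric])

lemma free_algebra_ops: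
  "f \<oplus>\<^bsub>free_algebra G\<^esub> g = f + g" "f \<otimes>\<^bsub>free_algebra G\<^esub> g = f * g"
  "\<one>\<^bsub>free_algebra G\<^esub> = 1" "\<zero>\<^bsub>free_algebra G\<^esub> = 0"
  by (simp_all add: free_algebra_def)

section \<open>Inversions of blocks and of lists\<close>

text \<open>For disjoint sets every pair is inverted in exactly one of the two orders. This produces
  the complementary exponents when the two blocks of columns trade places.\<close>

lemma inversions_between_flip:
  assumes "finite I" "finite J" "I \<inter> J = {}"
  shows "inversions_between I J + inversions_between J I = card I * card J"
proof -
  let ?A = "{(i, j). i \<in> I \<and> j \<in> J \<and> j < i}" and ?B = "{(j, i). j \<in> J \<and> i \<in> I \<and> i < j}"
  have sub: "?A \<subseteq> I \<times> J" "?B \<subseteq> J \<times> I" by auto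
  have fin: "finite ?A" "finite ?B"
    using assms by (auto intro: finite_subset[OF sub(1)] finite_subset[OF sub(2)])
  have "card ?A + card ?B = card ?A + card (prod.swap ` ?B)"
    by (simp add: card_image)
  also have "\<dots> = card (?A \<union> prod.swap ` ?B)"
    using fin by (intro card_Un_disjoint[symmetric]) auto
  also have "?A \<union> prod.swap ` ?B = I \<times> J"
    using assms(3) by (auto simp: image_iff)
  finally show ?thesis
    by (simp add: inversions_between_def card_cartesian_product)
qed

text \<open>An inverted pair either uses position 0, and is then determined by an entry of
  \<open>xs\<close> below \<open>x\<close>, or is an inverted pair of \<open>xs\<close> shifted by
  one position. The count matches one step of the recursion of \<open>row_det\<close>.\<close>

lemma inversion_number_nth_Cons:
  assumes "distinct xs"
  shows "inversion_number {..<Suc (length xs)} (nth (x # xs)) =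
    pos_in (set xs) x + inversion_number {..<length xs} (nth xs)"
proof -
  let ?first = "{j. j < length xs \<and> xs ! j < x}"
  let ?rest = "{(i, j). i \<in> {..<length xs} \<and> j \<in> {..<length xs} \<and> i < j \<and> xs ! j < xs ! i}"
  have "?rest \<subseteq> {..<length xs} \<times> {..<length xs}" by auto
  then have fin: "finite ?rest" by (rule finite_subset) simp
  have "{(i, j). i \<in> {..<Suc (length xs)} \<and> j \<in> {..<Suc (length xs)} \<and> i < j \<and>
      (x # xs) ! j < (x # xs) ! i} = (\<lambda>j. (0, Suc j)) ` ?first \<union> map_prod Suc Suc ` ?rest" (is "?L = ?R")
  proof (intro equalityI subsetI)
    fix p assume "p \<in> ?L"
    then obtain i j where p: "p = (i, j)" "i < Suc (length xs)" "j < Suc (length xs)" "i < j"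
      "(x # xs) ! j < (x # xs) ! i" by auto
    then obtain j' where j': "j = Suc j'" by (cases j) auto
    show "p \<in> ?R"
    proof (cases i)
      case 0
      then have "j' \<in> ?first" using p j' by simp
      then show ?thesis using p(1) 0 j' by blast
    next
      case (Suc i')
      then have "(i', j') \<in> ?rest" using p j' by simp
      then show ?thesis using p(1) Suc j' by (intro UnI2 image_eqI[of _ _ "(i', j')"]) simp_all
    qed
  qed auto
  moreover have "card ((\<lambda>j. (0 :: nat, Suc j)) ` ?first \<union> map_prod Suc Suc ` ?rest) = card ?first + card ?rest"
  proof (subst card_Un_disjoint)
    show "card ((\<lambda>j. (0 :: nat, Suc j)) ` ?first) + card (map_prod Suc Suc ` ?rest) = card ?first + card ?rest"
      by (intro arg_cong2[of _ _ _ _ "(+)"] card_image) (auto simp: inj_on_def)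
  qed (use fin in auto)
  \<comment> \<open>\<open>pos_in\<close> counts values, not positions; distinctness of
    \<open>xs\<close> makes \<open>nth\<close> a bijection between the two.\<close>
  moreover have "card ?first = card {y \<in> set xs. y < x}"
  proof (rule bij_betw_same_card)
    show "bij_betw (nth xs) ?first {y \<in> set xs. y < x}"
      unfolding bij_betw_def
      by (auto simp: inj_on_def nth_eq_iff_index_eq[OF assms] in_set_conv_nth image_iff)
  qed
  ultimately show ?thesis
    by (simp only: inversion_number_def pos_in_def)
qed

text \<open>Quantum minors sum over permutations of positions, row determinants over orderings of
  the columns; this is the change of variables. Distinct entries give injectivity, and an ordering
  of the same set has the same multiset, which gives surjectivity.\<close>

lemma bij_betw_permute_list:
  assumes "distinct xs"
  shows "bij_betw (\<lambda>\<sigma>. permute_list \<sigma> xs) {\<sigma>. \<sigma> permutes {..<length xs}} (permutations_of_set (set xs))"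
  unfolding bij_betw_def
proof
  show "inj_on (\<lambda>\<sigma>. permute_list \<sigma> xs) {\<sigma>. \<sigma> permutes {..<length xs}}"
  proof (rule inj_onI, clarsimp)
    fix \<sigma> \<tau> assume *: "\<sigma> permutes {..<length xs}" "\<tau> permutes {..<length xs}"
      "permute_list \<sigma> xs = permute_list \<tau> xs"
    have "\<sigma> k = \<tau> k" for k
    proof (cases "k < length xs")
      case True
      then have "xs ! \<sigma> k = xs ! \<tau> k"
        using permute_list_nth[OF *(1) True] permute_list_nth[OF *(2) True] *(3) by simp
      moreover have "\<sigma> k < length xs" "\<tau> k < length xs"
        using True permutes_in_image[OF *(1), of k] permutes_in_image[OF *(2), of k] by simp_all
      ultimately show ?thesis
        by (simp add: nth_eq_iff_index_eq[OF assms])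
    next
      case False
      then show ?thesis
        using permutes_not_in[OF *(1), of k] permutes_not_in[OF *(2), of k] by simp
    qed
    then show "\<sigma> = \<tau>" by (rule ext)
  qed
  show "(\<lambda>\<sigma>. permute_list \<sigma> xs) ` {\<sigma>. \<sigma> permutes {..<length xs}} = permutations_of_set (set xs)"
  proof (intro equalityI subsetI)
    fix ys assume "ys \<in> permutations_of_set (set xs)"
    then have "mset ys = mset xs"
      using assms set_eq_iff_mset_eq_distinct[of ys xs] by (auto dest: permutations_of_setD)
    then obtain \<sigma> where "\<sigma> permutes {..<length xs}" "permute_list \<sigma> xs = ys"
      by (rule mset_eq_permutation)
    then show "ys \<in> (\<lambda>\<sigma>. permute_list \<sigma> xs) ` {\<sigma>. \<sigma> permutes {..<length xs}}" by blast
  qed (use assms in \<open>auto intro!: permutations_of_setI\<close>)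
qed

text \<open>Row list of the complementary minor when a determinant is expanded along a column;
  positions are counted from 0.\<close>

definition delete_nth :: "nat \<Rightarrow> 'b list \<Rightarrow> 'b list" where
  "delete_nth k xs = take k xs @ drop (Suc k) xs"

lemma delete_nth_Cons [simp]:
  "delete_nth 0 (x # xs) = xs" "delete_nth (Suc k) (x # xs) = x # delete_nth k xs"
  by (simp_all add: delete_nth_def)

lemma set_delete_nth: "set (delete_nth k xs) \<subseteq> set xs"
  by (auto simp: delete_nth_def dest: in_set_takeD in_set_dropD)

lemma length_delete_nth: "k < length xs \<Longrightarrow> length (delete_nth k xs) = length xs - 1"
  by (simp add: delete_nth_def)

lemma sorted_delete_nth: "sorted_wrt (<) xs \<Longrightarrow> sorted_wrt (<) (delete_nth k xs)" for xs :: "nat list"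
proof (induction xs arbitrary: k)
  case (Cons x xs)
  then show ?case
    using set_delete_nth[of _ xs] by (cases k) (auto simp: subset_iff)
qed (simp add: delete_nth_def)

subsection \<open>Row determinants modulo the quantum matrix relations\<close>

context
  fixes q :: complex and N :: nat
begin

section \<open>Congruence modulo the defining ideal\<close>

definition index_range :: "nat set" where
  "index_range = {1..N}"

definition elements :: "(nat \<times> nat) free set" where
  "elements = carrier (qmat_free N)"

text \<open>Arguing with representatives keeps the type class arithmetic of the free algebra
  available. Membership in \<open>elements\<close> becomes a side condition only for multipliers and
  in the passage to cosets.\<close>

definition qcong :: "(nat \<times> nat) free \<Rightarrow> (nat \<times> nat) free \<Rightarrow> bool" (infix "\<cong>\<^sub>q" 50) where
  "f \<cong>\<^sub>q g \<longleftrightarrow> f - g \<in> qmat_ideal q N"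

definition qpow :: "nat \<Rightarrow> (nat \<times> nat) free" where
  "qpow k = free_scalar ((-q) ^ k)"

abbreviation gen :: "nat \<Rightarrow> nat \<Rightarrow> (nat \<times> nat) free" where
  "gen i j \<equiv> free_gen (i, j)"

text \<open>The factors stay in the order of the list of rows. The exponent
  \<open>pos_in C c\<close> counts the inversions of \<open>c\<close> with the smaller columns left
  to later rows; with as many rows as columns these exponents add up to the inversion
  number.\<close>

fun row_det :: "nat list \<Rightarrow> nat set \<Rightarrow> (nat \<times> nat) free" where
  "row_det [] C = 1"
| "row_det (b # bs) C = (\<Sum>c\<in>C. qpow (pos_in C c) * (gen b c * row_det bs (C - {c})))"

lemma qpow_0 [simp]: "qpow 0 = 1"
  by (simp add: qpow_def free_scalar_one)

lemma qpow_add: "qpow j * qpow k = qpow (j + k)" "qpow j * (qpow k * x) = qpow (j + k) * x"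
  by (simp_all add: qpow_def free_scalar_mult power_add)

lemma mult_qpow:
  "x * (qpow k * y) = qpow k * (x * y)"
  unfolding qpow_def by (rule mult_free_scalar)

text \<open>Collects powers of \<open>-q\<close> in front. The left factors are restricted to
  determinants and generators, so that no power of \<open>-q\<close> is moved past another one; such
  powers are merged by \<open>qpow_add\<close>.\<close>

lemmas qpow_left = mult_qpow[of "row_det bs C" for bs C] mult_qpow[of "gen i j" for i j]

lemma elements_ops:
  "f \<in> elements \<Longrightarrow> g \<in> elements \<Longrightarrow> f + g \<in> elements"
  "f \<in> elements \<Longrightarrow> g \<in> elements \<Longrightarrow> f * g \<in> elements"
  "f \<in> elements \<Longrightarrow> - f \<in> elements"
  "0 \<in> elements" "1 \<in> elements"
  unfolding elements_def
  using ring.ring_simprules(1,2,5,6)[OF ring_free_algebra]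
  by (simp_all add: free_algebra_ops) (simp_all add: free_algebra_def)

lemma elements_sum: "(\<And>x. x \<in> A \<Longrightarrow> f x \<in> elements) \<Longrightarrow> sum f A \<in> elements"
  by (induction A rule: infinite_finite_induct) (auto simp: elements_ops)

lemma elements_scalar: "free_scalar c \<in> elements"
  unfolding elements_def by (rule free_scalar_closed)

lemma elements_qpow: "qpow k \<in> elements"
  unfolding qpow_def by (rule elements_scalar)

lemma elements_gen: "i \<in> index_range \<Longrightarrow> j \<in> index_range \<Longrightarrow> gen i j \<in> elements"
  by (simp add: elements_def index_range_def free_algebra_def free_gen_def)

lemmas elements_intros = elements_ops elements_sum elements_scalar elements_qpow elements_gen

lemma elements_row_det:
  "set bs \<subseteq> index_range \<Longrightarrow> C \<subseteq> index_range \<Longrightarrow> row_det bs C \<in> elements"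
proof (induction bs arbitrary: C)
  case (Cons b bs)
  have "row_det bs (C - {c}) \<in> elements" for c
    using Cons.prems by (intro Cons.IH) auto
  then show ?case
    unfolding row_det.simps using Cons.prems by (intro elements_intros) auto
qed (simp add: elements_ops)

lemma qmat_ideal_closed:
  "f \<in> qmat_ideal q N \<Longrightarrow> g \<in> qmat_ideal q N \<Longrightarrow> f + g \<in> qmat_ideal q N"
  "f \<in> qmat_ideal q N \<Longrightarrow> - f \<in> qmat_ideal q N"
  "0 \<in> qmat_ideal q N"
  "h \<in> elements \<Longrightarrow> f \<in> qmat_ideal q N \<Longrightarrow> h * f \<in> qmat_ideal q N"
  "h \<in> elements \<Longrightarrow> f \<in> qmat_ideal q N \<Longrightarrow> f * h \<in> qmat_ideal q N"
proof -
  interpret I: ideal "qmat_ideal q N" "qmat_free N" by (rule ideal_qmat_ideal)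
  note closed = additive_subgroup.a_closed[OF I.additive_subgroup_axioms]
    additive_subgroup.zero_closed[OF I.additive_subgroup_axioms] I.I_l_closed I.I_r_closed
  show "f \<in> qmat_ideal q N \<Longrightarrow> g \<in> qmat_ideal q N \<Longrightarrow> f + g \<in> qmat_ideal q N" "0 \<in> qmat_ideal q N"
    "h \<in> elements \<Longrightarrow> f \<in> qmat_ideal q N \<Longrightarrow> f * h \<in> qmat_ideal q N"
    and l: "h \<in> elements \<Longrightarrow> f \<in> qmat_ideal q N \<Longrightarrow> h * f \<in> qmat_ideal q N" for f g h
    using closed[unfolded free_algebra_ops] by (simp_all add: elements_def)
  show "f \<in> qmat_ideal q N \<Longrightarrow> - f \<in> qmat_ideal q N"
    using l[of "- 1" f] by (simp add: elements_ops)
qed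

lemma qcong_refl [simp, intro]: "f \<cong>\<^sub>q f"
  by (simp add: qcong_def qmat_ideal_closed)

lemma qcong_sym: "f \<cong>\<^sub>q g \<Longrightarrow> g \<cong>\<^sub>q f"
  unfolding qcong_def using qmat_ideal_closed(2)[of "f - g"] by simp

lemma qcong_trans [trans]: "f \<cong>\<^sub>q g \<Longrightarrow> g \<cong>\<^sub>q h \<Longrightarrow> f \<cong>\<^sub>q h"
  unfolding qcong_def using qmat_ideal_closed(1)[of "f - g" "g - h"] by simp

lemma qcong_add: "f \<cong>\<^sub>q g \<Longrightarrow> f' \<cong>\<^sub>q g' \<Longrightarrow> f + f' \<cong>\<^sub>q g + g'"
  unfolding qcong_def using qmat_ideal_closed(1)[of "f - g" "f' - g'"] by (simp add: algebra_simps)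

lemma qcong_sum: "(\<And>x. x \<in> A \<Longrightarrow> f x \<cong>\<^sub>q g x) \<Longrightarrow> sum f A \<cong>\<^sub>q sum g A"
  by (induction A rule: infinite_finite_induct) (auto intro: qcong_add)

lemma qcong_mult_left: "h \<in> elements \<Longrightarrow> f \<cong>\<^sub>q g \<Longrightarrow> h * f \<cong>\<^sub>q h * g"
  unfolding qcong_def using qmat_ideal_closed(4)[of h "f - g"] by (simp add: algebra_simps)

lemma qcong_mult_right: "h \<in> elements \<Longrightarrow> f \<cong>\<^sub>q g \<Longrightarrow> f * h \<cong>\<^sub>q g * h"
  unfolding qcong_def using qmat_ideal_closed(5)[of h "f - g"] by (simp add: algebra_simps)

lemma qmat_relations_subset: "qmat_relations q N \<subseteq> qmat_ideal q N"
  by (auto simp: qmat_ideal_def genideal_def)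

text \<open>This is the third family of relations: the factor with the larger row has the smaller
  column. Together with the fourth family in \<open>qcong_cross\<close> it governs two generators in
  distinct rows and distinct columns.\<close>

lemma qcong_commute:
  assumes "i \<in> index_range" "j \<in> index_range" "k \<in> index_range" "l \<in> index_range" "i < j" "k < l"
  shows "gen j k * gen i l \<cong>\<^sub>q gen i l * gen j k"
  unfolding qcong_def
  by (rule subsetD[OF qmat_relations_subset], unfold qmat_relations_def Let_def index_range_def[symmetric]) (use assms in blast)

lemma qcong_cross:
  assumes "i \<in> index_range" "j \<in> index_range" "k \<in> index_range" "l \<in> index_range" "i < j" "k < l"
  shows "gen i k * gen j l \<cong>\<^sub>q gen j l * gen i k + free_scalar (q - inverse q) * (gen i l * gen j k)"
proof -
  have "gen i k * gen j l - gen j l * gen i k - free_scalar (q - inverse q) * gen i l * gen j k \<in> qmat_ideal q N"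
    by (rule subsetD[OF qmat_relations_subset], unfold qmat_relations_def Let_def index_range_def[symmetric]) (use assms in blast)
  then show ?thesis
    by (simp add: qcong_def algebra_simps)
qed

section \<open>Laplace expansion along rows\<close>

text \<open>Once the set \<open>I\<close> of columns used by the rows \<open>bs\<close> is fixed,
  the choices inside \<open>I\<close> and inside \<open>C - I\<close> are independent. The
  inversions across the two blocks depend on \<open>I\<close> alone and give the power in
  front.\<close>

lemma row_det_append:
  assumes "finite C"
  shows "row_det (bs @ ts) C =
    (\<Sum>I\<in>{I. I \<subseteq> C \<and> card I = length bs}.
       qpow (inversions_between I (C - I)) * (row_det bs I * row_det ts (C - I)))"
  using assms
proof (induction bs arbitrary: C)
  case Nil
  have "{I. I \<subseteq> C \<and> card I = 0} = {{}}"
    using Nil by (auto dest: finite_subset)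
  then show ?case by simp
next
  case (Cons b bs)
  have card_insert: "card (insert c I) = Suc (card I)" if "I \<subseteq> C - {c}" for c I
    using that Cons.prems by (subst card_insert_disjoint) (auto dest: finite_subset)
  let ?term = "\<lambda>I c. qpow (inversions_between I (C - I) + pos_in I c) *
    (gen b c * (row_det bs (I - {c}) * row_det ts (C - I)))"
  have "row_det ((b # bs) @ ts) C = (\<Sum>c\<in>C. \<Sum>I\<in>{I. I \<subseteq> C - {c} \<and> card I = length bs}.
     qpow (pos_in C c + inversions_between I (C - {c} - I)) *
      (gen b c * (row_det bs I * row_det ts (C - {c} - I))))"
    using Cons.prems by (simp add: Cons.IH sum_distrib_left qpow_left qpow_add)
  also have "\<dots> = (\<Sum>(c, I)\<in>(SIGMA c:C. {I. I \<subseteq> C - {c} \<and> card I = length bs}).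
     qpow (pos_in C c + inversions_between I (C - {c} - I)) *
      (gen b c * (row_det bs I * row_det ts (C - {c} - I))))"
    using Cons.prems by (intro sum.Sigma) auto
  also have "\<dots> = (\<Sum>(I, c)\<in>(SIGMA I:{I. I \<subseteq> C \<and> card I = length (b # bs)}. I). ?term I c)"
  \<comment> \<open>Choosing the column \<open>c\<close> of row \<open>b\<close> and then the set
    \<open>I\<close> for the rows \<open>bs\<close> amounts to choosing the whole set
    \<open>insert c I\<close> and then a member \<open>c\<close> of it.\<close>
  proof (rule sum.reindex_bij_witness[of _ "\<lambda>(I, c). (c, I - {c})" "\<lambda>(c, I). (insert c I, c)"];
      clarify)
    fix c I assume c: "c \<in> C" and I: "I \<subseteq> C - {c}" "card I = length bs"
    have fin: "finite I" "finite (C - insert c I)" and "c \<notin> I"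
      using I Cons.prems by (auto dest: finite_subset)
    \<comment> \<open>Columns below \<open>c\<close> inside \<open>insert c I\<close> belong to the
      expansion of \<open>row_det (b # bs)\<close>, those outside it to the inversions across the
      blocks.\<close>
    then have "pos_in C c = pos_in (insert c I) c + pos_in (C - insert c I) c"
      using c I by (subst pos_in_Un_disjoint[symmetric]) (auto intro!: arg_cong2[of _ _ _ _ pos_in])
    moreover have "inversions_between (insert c I) (C - insert c I) =
        pos_in (C - insert c I) c + inversions_between I (C - insert c I)"
      using fin \<open>c \<notin> I\<close> by (simp add: inversions_between_insert)
    moreover have "C - {c} - I = C - insert c I" "insert c I - {c} = I"
      using \<open>c \<notin> I\<close> by auto
    ultimately show "?term (insert c I) c = qpow (pos_in C c + inversions_between I (C - {c} - I)) *
      (gen b c * (row_det bs I * row_det ts (C - {c} - I)))"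
      by (simp add: add_ac)
  qed (use Cons.prems in \<open>auto dest: finite_subset simp: card_insert\<close>)
  also have "\<dots> = (\<Sum>I\<in>{I. I \<subseteq> C \<and> card I = length (b # bs)}. \<Sum>c\<in>I. ?term I c)"
    using Cons.prems by (intro sum.Sigma[symmetric]) (auto dest: finite_subset)
  also have "\<dots> = (\<Sum>I\<in>{I. I \<subseteq> C \<and> card I = length (b # bs)}.
      qpow (inversions_between I (C - I)) * (row_det (b # bs) I * row_det ts (C - I)))"
    by (intro sum.cong) (simp_all add: sum_distrib_right sum_distrib_left qpow_left qpow_add mult.assoc)
  finally show ?case .
qed

section \<open>Exchange of rows\<close>

text \<open>For columns c < d the first two rows contribute a 2 by 2 determinant times the common
  factor \<open>row_det bs (C - {c} - {d})\<close>, so everything reduces to two rows and two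
  columns.\<close>

lemma row_det_swap_first:
  assumes "q \<noteq> 0" "C \<subseteq> index_range" "set (x # y # bs) \<subseteq> index_range" "y < x"
  shows "row_det (x # y # bs) C \<cong>\<^sub>q qpow 1 * row_det (y # x # bs) C"
proof -
  have fin: "finite C"
    using assms(2) by (auto simp: index_range_def intro: finite_subset)
  have Diff_commute: "C - {d} - {c} = C - {c} - {d}" for c d
    by auto
  let ?D = "\<lambda>c d. row_det bs (C - {c} - {d})"
  let ?p = "pos_in C"
  \<comment> \<open>The power of \<open>-q\<close> for giving column \<open>c\<close> to the first
    row and \<open>d\<close> to the second.\<close>
  define E where "E c d = qpow (?p c + pos_in (C - {c}) d)" for c d
  have expand: "row_det (u # v # bs) C = (\<Sum>c\<in>C. \<Sum>d\<in>{d\<in>C. c < d}.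
      E c d * (gen u c * gen v d * ?D c d) + E d c * (gen u d * gen v c * ?D c d))" for u v
  proof -
    have "row_det (u # v # bs) C = (\<Sum>c\<in>C. \<Sum>d\<in>C - {c}. E c d * (gen u c * gen v d * ?D c d))"
      by (simp add: sum_distrib_left qpow_left qpow_add mult.assoc E_def)
    also have "(\<Sum>c\<in>C. \<Sum>d\<in>C - {c}. E c d * (gen u c * gen v d * ?D c d)) = (\<Sum>c\<in>C. \<Sum>d\<in>{d\<in>C. c < d}.
      E c d * (gen u c * gen v d * ?D c d) + E d c * (gen u d * gen v c * ?D d c))"
      by (rule sum_off_diagonal[OF fin])
    finally show ?thesis by (simp only: Diff_commute)
  qed
  have "E c d * (gen x c * gen y d * ?D c d) + E d c * (gen x d * gen y c * ?D c d) \<cong>\<^sub>q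
      qpow 1 * (E c d * (gen y c * gen x d * ?D c d) + E d c * (gen y d * gen x c * ?D c d))"
    if cd: "c \<in> C" "d \<in> C" "c < d" for c d
  proof -
    define k where "k = ?p c + pos_in (C - {c}) d"
    have Ecd: "E c d = qpow k" by (simp add: E_def k_def)
    \<comment> \<open>Giving out the larger column \<open>d\<close> first creates exactly one more
      inversion.\<close>
    have "pos_in (insert d (C - {d})) c = pos_in (C - {d}) c"
      using cd by (intro pos_in_insert_above) auto
    moreover have "pos_in (insert c (C - {c})) d = Suc (pos_in (C - {c}) d)"
      using cd fin by (intro pos_in_insert_below) auto
    ultimately have Edc: "E d c = qpow (Suc k)"
      using cd by (simp add: E_def k_def insert_absorb add.commute)
    have idx: "x \<in> index_range" "y \<in> index_range" "c \<in> index_range" "d \<in> index_range"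
      using assms cd by auto
    note comm = qcong_commute[OF idx(2,1,3,4) assms(4) cd(3)]
    note cross = qcong_cross[OF idx(2,1,3,4) assms(4) cd(3)]
    have "gen x c * gen y d + qpow 1 * (gen x d * gen y c) \<cong>\<^sub>q
        qpow 1 * (gen y c * gen x d) + qpow 2 * (gen y d * gen x c)"
    proof (rule qcong_sym)
      \<comment> \<open>The coefficient of \<open>gen y d * gen x c\<close> after
        \<open>qcong_cross\<close> has replaced \<open>gen y c * gen x d\<close>.\<close>
      have scalars: "-q * (q - inverse q) + q\<^sup>2 = 1"
        using assms(1) by (simp add: field_simps power2_eq_square)
      have "qpow 1 * (gen y c * gen x d) + qpow 2 * (gen y d * gen x c) \<cong>\<^sub>q
         qpow 1 * (gen x d * gen y c + free_scalar (q - inverse q) * (gen y d * gen x c)) + qpow 2 * (gen y d * gen x c)"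
        by (rule qcong_add[OF qcong_mult_left[OF elements_qpow cross] qcong_refl])
      also have "\<dots> = qpow 1 * (gen x d * gen y c) +
          (free_scalar (-q * (q - inverse q)) + free_scalar (q\<^sup>2)) * (gen y d * gen x c)"
        unfolding distrib_left distrib_right qpow_def free_scalar_mult(2) power_one_right
          power2_minus add.assoc ..
      also have "\<dots> = gen y d * gen x c + qpow 1 * (gen x d * gen y c)"
        unfolding free_scalar_add scalars free_scalar_one mult_1_left by (rule add.commute)
      also have "\<dots> \<cong>\<^sub>q gen x c * gen y d + qpow 1 * (gen x d * gen y c)"
        by (rule qcong_add[OF qcong_sym[OF comm] qcong_refl])
      finally show "qpow 1 * (gen y c * gen x d) + qpow 2 * (gen y d * gen x c) \<cong>\<^sub>q
        gen x c * gen y d + qpow 1 * (gen x d * gen y c)" .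
    qed
    then have "qpow k * (gen x c * gen y d + qpow 1 * (gen x d * gen y c)) * ?D c d \<cong>\<^sub>q
        qpow k * (qpow 1 * (gen y c * gen x d) + qpow 2 * (gen y d * gen x c)) * ?D c d"
      using assms by (intro qcong_mult_left qcong_mult_right elements_qpow elements_row_det) auto
    then show ?thesis
      by (simp add: Ecd Edc distrib_left distrib_right mult.assoc qpow_add numeral_2_eq_2)
  qed
  then have "(\<Sum>c\<in>C. \<Sum>d\<in>{d\<in>C. c < d}.
      E c d * (gen x c * gen y d * ?D c d) + E d c * (gen x d * gen y c * ?D c d)) \<cong>\<^sub>q
    (\<Sum>c\<in>C. \<Sum>d\<in>{d\<in>C. c < d}.
      qpow 1 * (E c d * (gen y c * gen x d * ?D c d) + E d c * (gen y d * gen x c * ?D c d)))"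
    by (intro qcong_sum) auto
  then show ?thesis
    unfolding expand sum_distrib_left .
qed

text \<open>The assumption ranges over all column sets because expanding along \<open>b\<close>
  removes a different column in every term.\<close>

lemma row_det_Cons_cong:
  assumes "\<And>C. C \<subseteq> index_range \<Longrightarrow> row_det bs C \<cong>\<^sub>q qpow k * row_det bs' C"
    and "b \<in> index_range" "C \<subseteq> index_range"
  shows "row_det (b # bs) C \<cong>\<^sub>q qpow k * row_det (b # bs') C"
proof -
  have "row_det (b # bs) C \<cong>\<^sub>q
      (\<Sum>c\<in>C. qpow (pos_in C c) * (gen b c * (qpow k * row_det bs' (C - {c}))))"
    unfolding row_det.simps using assms
    by (intro qcong_sum qcong_mult_left elements_qpow elements_gen assms(1)) auto
  also have "\<dots> = qpow k * row_det (b # bs') C"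
    by (simp add: sum_distrib_left qpow_left qpow_add add.commute)
  finally show ?thesis .
qed

text \<open>The row \<open>b\<close> exceeds every row that it passes, so each adjacent swap
  contributes one factor \<open>-q\<close>.\<close>

lemma row_det_move_first:
  assumes "q \<noteq> 0" "set (b # ts @ bs) \<subseteq> index_range" "C \<subseteq> index_range" "\<And>t. t \<in> set ts \<Longrightarrow> t < b"
  shows "row_det (b # ts @ bs) C \<cong>\<^sub>q qpow (length ts) * row_det (ts @ b # bs) C"
  using assms(2-)
proof (induction ts arbitrary: C)
  case (Cons t ts)
  have "row_det (b # t # ts @ bs) C \<cong>\<^sub>q qpow 1 * row_det (t # b # ts @ bs) C"
    using Cons.prems by (intro row_det_swap_first assms(1)) auto
  also have "\<dots> \<cong>\<^sub>q qpow 1 * (qpow (length ts) * row_det (t # ts @ b # bs) C)"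
    using Cons.prems by (intro qcong_mult_left elements_qpow row_det_Cons_cong Cons.IH) auto
  finally show ?case by (simp add: qpow_add)
qed simp

text \<open>By induction the remaining rows \<open>bs\<close> pass \<open>ts\<close> behind the
  first row \<open>b\<close>; then \<open>b\<close> itself passes \<open>ts\<close>, which adds
  \<open>length ts\<close> to the exponent.\<close>

lemma row_det_exchange_blocks:
  assumes "q \<noteq> 0" "set (bs @ ts) \<subseteq> index_range" "C \<subseteq> index_range"
    and "\<And>b t. b \<in> set bs \<Longrightarrow> t \<in> set ts \<Longrightarrow> t < b"
  shows "row_det (bs @ ts) C \<cong>\<^sub>q qpow (length bs * length ts) * row_det (ts @ bs) C"
  using assms(2-)
proof (induction bs arbitrary: C)
  case (Cons b bs)
  have "row_det (b # bs @ ts) C \<cong>\<^sub>q qpow (length bs * length ts) * row_det (b # ts @ bs) C"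
    using Cons.prems by (intro row_det_Cons_cong Cons.IH) auto
  also have "\<dots> \<cong>\<^sub>q qpow (length bs * length ts) * (qpow (length ts) * row_det (ts @ b # bs) C)"
    using Cons.prems by (intro qcong_mult_left elements_qpow row_det_move_first assms(1)) auto
  finally show ?case by (simp add: qpow_add add.commute)
qed simp

section \<open>Expansion along the first column\<close>

text \<open>After expansion along \<open>b\<close> with a column \<open>c > p\<close>, the induction
  hypothesis produces an entry of column \<open>p\<close> in a row larger than \<open>b\<close>.
  This entry commutes with \<open>gen b c\<close> and so moves to the front.\<close>

lemma row_det_first_column:
  assumes "sorted_wrt (<) bs" "length bs = Suc (card C)" "set bs \<subseteq> index_range"
    and "insert p C \<subseteq> index_range" "\<And>c. c \<in> C \<Longrightarrow> p < c"
  shows "row_det bs (insert p C) \<cong>\<^sub>q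
    (\<Sum>k<length bs. qpow k * (gen (bs ! k) p * row_det (delete_nth k bs) C))"
  using assms
proof (induction bs arbitrary: C)
  case (Cons b bs)
  have fin: "finite C" and p: "p \<notin> C"
    using Cons.prems by (auto simp: index_range_def intro: finite_subset)
  have "row_det (b # bs) (insert p C) = qpow (pos_in (insert p C) p) * (gen b p * row_det bs C) +
      (\<Sum>c\<in>C. qpow (pos_in (insert p C) c) * (gen b c * row_det bs (insert p C - {c})))"
    using fin p by simp
  also have "pos_in (insert p C) p = 0"
    using Cons.prems by (intro pos_in_eq_0) (auto simp: less_imp_le)
  \<comment> \<open>Since \<open>p\<close> is smaller than all of \<open>C\<close>, it raises every
    position by one; this turns the exponent \<open>k\<close> of the induction hypothesis into
    \<open>Suc k\<close>.\<close>
  also have "(\<Sum>c\<in>C. qpow (pos_in (insert p C) c) * (gen b c * row_det bs (insert p C - {c}))) =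
      (\<Sum>c\<in>C. qpow (Suc (pos_in C c)) * (gen b c * row_det bs (insert p (C - {c}))))"
    using fin p Cons.prems(5) by (intro sum.cong) (auto simp: pos_in_insert_below insert_Diff_if)
  also have "qpow 0 * (gen b p * row_det bs C) + \<dots> \<cong>\<^sub>q qpow 0 * (gen b p * row_det bs C) +
     (\<Sum>c\<in>C. qpow (Suc (pos_in C c)) * (gen b c *
        (\<Sum>k<length bs. qpow k * (gen (bs ! k) p * row_det (delete_nth k bs) (C - {c})))))"
  proof (intro qcong_add qcong_refl qcong_sum qcong_mult_left elements_qpow elements_gen)
    fix c assume c: "c \<in> C"
    have "length bs = card C"
      using Cons.prems(2) by simp
    also have "\<dots> = Suc (card (C - {c}))"
      by (rule card.remove[OF fin c])
    finally show "row_det bs (insert p (C - {c})) \<cong>\<^sub>q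
        (\<Sum>k<length bs. qpow k * (gen (bs ! k) p * row_det (delete_nth k bs) (C - {c})))"
      using c Cons.prems by (intro Cons.IH) auto
  qed (use Cons.prems in auto)
  also have "(\<Sum>c\<in>C. qpow (Suc (pos_in C c)) * (gen b c *
        (\<Sum>k<length bs. qpow k * (gen (bs ! k) p * row_det (delete_nth k bs) (C - {c}))))) =
      (\<Sum>c\<in>C. \<Sum>k<length bs. qpow (Suc k + pos_in C c) *
        (gen b c * gen (bs ! k) p * row_det (delete_nth k bs) (C - {c})))"
    by (simp add: sum_distrib_left qpow_left qpow_add mult.assoc add.commute)
  also have "qpow 0 * (gen b p * row_det bs C) + \<dots> \<cong>\<^sub>q qpow 0 * (gen b p * row_det bs C) +
      (\<Sum>c\<in>C. \<Sum>k<length bs. qpow (Suc k + pos_in C c) *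
        (gen (bs ! k) p * gen b c * row_det (delete_nth k bs) (C - {c})))"
  proof (intro qcong_add qcong_refl qcong_sum qcong_mult_left qcong_mult_right elements_qpow)
    fix c k assume "c \<in> C" "k \<in> {..<length bs}"
    then show "gen b c * gen (bs ! k) p \<cong>\<^sub>q gen (bs ! k) p * gen b c"
      using Cons.prems nth_mem[of k bs] by (intro qcong_sym[OF qcong_commute]) auto
    show "row_det (delete_nth k bs) (C - {c}) \<in> elements"
      using Cons.prems set_delete_nth[of k bs] by (intro elements_row_det) auto
  qed
  \<comment> \<open>For fixed \<open>k\<close> the sum over \<open>c\<close> is the expansion of
    \<open>row_det (b # delete_nth k bs) C\<close> along \<open>b\<close>. The term in which
    \<open>b\<close> itself takes \<open>p\<close> becomes the one with index 0.\<close>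
  also have "(\<Sum>c\<in>C. \<Sum>k<length bs. qpow (Suc k + pos_in C c) *
        (gen (bs ! k) p * gen b c * row_det (delete_nth k bs) (C - {c}))) =
      (\<Sum>k<length bs. qpow (Suc k) * (gen (bs ! k) p * row_det (b # delete_nth k bs) C))"
    by (subst sum.swap) (simp add: sum_distrib_left qpow_left qpow_add mult.assoc)
  also have "qpow 0 * (gen b p * row_det bs C) + \<dots> = (\<Sum>k<length (b # bs).
      qpow k * (gen ((b # bs) ! k) p * row_det (delete_nth k (b # bs)) C))"
    by (simp add: sum.lessThan_Suc_shift del: sum.lessThan_Suc row_det.simps)
  finally show ?case .
qed simp

text \<open>Every generator in \<open>row_det ts C\<close> has a smaller row and a larger column
  than \<open>gen b p\<close>, so the third family of relations lets \<open>gen b p\<close> pass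
  it.\<close>

lemma gen_row_det_commute:
  assumes "b \<in> index_range" "p \<in> index_range" "set ts \<subseteq> index_range" "C \<subseteq> index_range"
    and "\<And>t. t \<in> set ts \<Longrightarrow> t < b" "\<And>c. c \<in> C \<Longrightarrow> p < c"
  shows "gen b p * row_det ts C \<cong>\<^sub>q row_det ts C * gen b p"
  using assms
proof (induction ts arbitrary: C)
  case (Cons t ts)
  have "gen b p * row_det (t # ts) C =
      (\<Sum>c\<in>C. qpow (pos_in C c) * (gen b p * gen t c * row_det ts (C - {c})))"
    by (simp add: sum_distrib_left qpow_left mult.assoc)
  also have "\<dots> \<cong>\<^sub>q (\<Sum>c\<in>C. qpow (pos_in C c) * (gen t c * gen b p * row_det ts (C - {c})))"
    using Cons.prems
    by (intro qcong_sum qcong_mult_left qcong_mult_right elements_qpow elements_row_det qcong_commute) auto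
  also have "\<dots> = (\<Sum>c\<in>C. qpow (pos_in C c) * (gen t c * (gen b p * row_det ts (C - {c}))))"
    by (simp add: mult.assoc)
  also have "\<dots> \<cong>\<^sub>q (\<Sum>c\<in>C. qpow (pos_in C c) * (gen t c * (row_det ts (C - {c}) * gen b p)))"
    using Cons.prems
    by (intro qcong_sum qcong_mult_left elements_qpow elements_gen Cons.IH) auto
  also have "\<dots> = row_det (t # ts) C * gen b p"
    by (simp add: sum_distrib_right mult.assoc)
  finally show ?case .
qed simp

section \<open>Exchange of the two minors in a Laplace sum\<close>

text \<open>Here \<open>ps\<close> lists the fixed columns and \<open>m\<close> counts the free
  columns of the minor with rows \<open>bs\<close>. An induction step removes one fixed column and
  one row, so \<open>bs\<close> varies, while \<open>E\<close>, \<open>m\<close> and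
  \<open>ts\<close>, and with them the factor \<open>qpow (m * length ts)\<close>, stay the
  same.\<close>

lemma laplace_sum_exchange:
  assumes "q \<noteq> 0" "sorted_wrt (<) bs" "sorted_wrt (<) ps" "length bs = length ps + m"
    and "card E = length ts + m" "set bs \<subseteq> index_range" "set ts \<subseteq> index_range"
    and "set ps \<subseteq> index_range" "E \<subseteq> index_range"
    and "\<And>b t. b \<in> set bs \<Longrightarrow> t \<in> set ts \<Longrightarrow> t < b"
    and "\<And>p e. p \<in> set ps \<Longrightarrow> e \<in> E \<Longrightarrow> p < e"
  shows "(\<Sum>I\<in>{I. I \<subseteq> E \<and> card I = m}. qpow (inversions_between I (E - I)) *
       (row_det bs (set ps \<union> I) * row_det ts (E - I))) \<cong>\<^sub>q
    qpow (m * length ts) * (\<Sum>I\<in>{I. I \<subseteq> E \<and> card I = m}. qpow (inversions_between (E - I) I) *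
       (row_det ts (E - I) * row_det bs (set ps \<union> I)))"
  using assms(2-)
proof (induction ps arbitrary: bs)
  case Nil
  have fin: "finite E"
    using Nil.prems by (auto simp: index_range_def intro: finite_subset)
  have "(\<Sum>I\<in>{I. I \<subseteq> E \<and> card I = m}. qpow (inversions_between I (E - I)) *
       (row_det bs I * row_det ts (E - I))) = row_det (bs @ ts) E"
    using Nil.prems by (simp add: row_det_append[OF fin])
  also have "\<dots> \<cong>\<^sub>q qpow (length bs * length ts) * row_det (ts @ bs) E"
    using Nil.prems by (intro row_det_exchange_blocks assms(1)) auto
  \<comment> \<open>\<open>row_det_append\<close> sums over the columns of \<open>ts\<close>;
    complements in \<open>E\<close> make the columns \<open>I\<close> of \<open>bs\<close> the
    index.\<close>
  also have "row_det (ts @ bs) E = (\<Sum>I\<in>{I. I \<subseteq> E \<and> card I = m}. qpow (inversions_between (E - I) I) *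
       (row_det ts (E - I) * row_det bs I))"
    unfolding row_det_append[OF fin]
    using fin Nil.prems
    by (intro sum.reindex_bij_witness[of _ "\<lambda>I. E - I" "\<lambda>I. E - I"])
       (auto simp: double_diff card_Diff_subset finite_subset)
  finally show ?case
    using Nil.prems by simp
next
  case (Cons p ps)
  define S where "S = {I. I \<subseteq> E \<and> card I = m}"
  have fin: "finite E"
    using Cons.prems by (auto simp: index_range_def intro: finite_subset)
  have expand: "row_det bs (set (p # ps) \<union> I) \<cong>\<^sub>q
      (\<Sum>k<length bs. qpow k * (gen (bs ! k) p * row_det (delete_nth k bs) (set ps \<union> I)))"
    if "I \<in> S" for I
  proof -
    have "finite I" "distinct ps"
      using that Cons.prems fin by (auto simp: S_def finite_subset strict_sorted_iff)
    \<comment> \<open>A common element would be smaller than itself. Disjointness of fixed and free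
      columns is what makes the column count match the number of rows.\<close>
    moreover have "p' \<notin> I" if "p' \<in> set ps" for p'
      using that \<open>I \<in> S\<close> Cons.prems(10)[of p' p'] by (auto simp: S_def)
    then have "set ps \<inter> I = {}" by blast
    ultimately have "length bs = Suc (card (set ps \<union> I))"
      using that Cons.prems by (simp add: card_Un_disjoint distinct_card S_def)
    then show ?thesis
      using that Cons.prems unfolding list.set Un_insert_left
      by (intro row_det_first_column) (auto simp: S_def)
  qed
  have row_in: "bs ! k \<in> set bs" "bs ! k \<in> index_range" if "k < length bs" for k
    using that Cons.prems by auto
  have col_in: "row_det ts (E - I) \<in> elements" for I
    using Cons.prems by (intro elements_row_det) auto
  have "(\<Sum>I\<in>S. qpow (inversions_between I (E - I)) * (row_det bs (set (p # ps) \<union> I) * row_det ts (E - I))) \<cong>\<^sub>q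
    (\<Sum>I\<in>S. qpow (inversions_between I (E - I)) *
      ((\<Sum>k<length bs. qpow k * (gen (bs ! k) p * row_det (delete_nth k bs) (set ps \<union> I))) * row_det ts (E - I)))"
    by (intro qcong_sum qcong_mult_left qcong_mult_right elements_qpow col_in expand)
  \<comment> \<open>Interchanging the sums leaves, for each \<open>k\<close>, a Laplace sum with one
    fixed column fewer, to which the induction hypothesis applies.\<close>
  also have "\<dots> = (\<Sum>k<length bs. qpow k * (gen (bs ! k) p * (\<Sum>I\<in>S. qpow (inversions_between I (E - I)) *
      (row_det (delete_nth k bs) (set ps \<union> I) * row_det ts (E - I)))))"
    by (simp add: sum_distrib_left sum_distrib_right qpow_left qpow_add mult.assoc add.commute)
      (rule sum.swap)
  also have "\<dots> \<cong>\<^sub>q (\<Sum>k<length bs. qpow k * (gen (bs ! k) p * (qpow (m * length ts) *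
      (\<Sum>I\<in>S. qpow (inversions_between (E - I) I) *
        (row_det ts (E - I) * row_det (delete_nth k bs) (set ps \<union> I))))))"
  proof (intro qcong_sum qcong_mult_left elements_qpow elements_gen)
    fix k assume k: "k \<in> {..<length bs}"
    show "(\<Sum>I\<in>S. qpow (inversions_between I (E - I)) *
        (row_det (delete_nth k bs) (set ps \<union> I) * row_det ts (E - I))) \<cong>\<^sub>q
      qpow (m * length ts) * (\<Sum>I\<in>S. qpow (inversions_between (E - I) I) *
        (row_det ts (E - I) * row_det (delete_nth k bs) (set ps \<union> I)))"
      unfolding S_def using Cons.prems k set_delete_nth[of k bs]
      by (intro Cons.IH) (auto simp: length_delete_nth sorted_delete_nth)
  qed (use row_in Cons.prems in auto)
  also have "\<dots> = qpow (m * length ts) * (\<Sum>I\<in>S. \<Sum>k<length bs. qpow (k + inversions_between (E - I) I) *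
      (gen (bs ! k) p * row_det ts (E - I) * row_det (delete_nth k bs) (set ps \<union> I)))"
    by (subst sum.swap) (simp add: sum_distrib_left qpow_left qpow_add mult.assoc add_ac)
  \<comment> \<open>The entry split off stands left of the minor with rows \<open>ts\<close>. Moving
    it across that minor brings it next to its complementary minor, so that the first column
    expansion can be reversed.\<close>
  also have "\<dots> \<cong>\<^sub>q qpow (m * length ts) * (\<Sum>I\<in>S. \<Sum>k<length bs. qpow (k + inversions_between (E - I) I) *
      (row_det ts (E - I) * gen (bs ! k) p * row_det (delete_nth k bs) (set ps \<union> I)))"
  proof (intro qcong_sum qcong_mult_left qcong_mult_right elements_qpow)
    fix I k assume *: "I \<in> S" "k \<in> {..<length bs}"
    show "gen (bs ! k) p * row_det ts (E - I) \<cong>\<^sub>q row_det ts (E - I) * gen (bs ! k) p"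
      using Cons.prems * row_in[of k] by (intro gen_row_det_commute) auto
    show "row_det (delete_nth k bs) (set ps \<union> I) \<in> elements"
      using Cons.prems * set_delete_nth[of k bs] by (intro elements_row_det) (auto simp: S_def)
  qed
  also have "\<dots> = qpow (m * length ts) * (\<Sum>I\<in>S. qpow (inversions_between (E - I) I) *
      (row_det ts (E - I) *
        (\<Sum>k<length bs. qpow k * (gen (bs ! k) p * row_det (delete_nth k bs) (set ps \<union> I)))))"
    by (simp add: sum_distrib_left qpow_left qpow_add mult.assoc add.commute)
  also have "\<dots> \<cong>\<^sub>q qpow (m * length ts) * (\<Sum>I\<in>S. qpow (inversions_between (E - I) I) *
      (row_det ts (E - I) * row_det bs (set (p # ps) \<union> I)))"
    by (intro qcong_mult_left qcong_sum elements_qpow col_in qcong_sym[OF expand])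
  finally show ?case unfolding S_def .
qed

section \<open>Row determinants as sums over orderings\<close>

text \<open>An ordering of \<open>C\<close> is a first column \<open>c\<close> followed by an
  ordering of the rest, and \<open>inversion_number_nth_Cons\<close> splits its inversions in the
  same way.\<close>

lemma row_det_permutations:
  assumes "finite C" "length bs = card C"
  shows "row_det bs C = (\<Sum>cs\<in>permutations_of_set C.
    qpow (inversion_number {..<length bs} (nth cs)) * prod_list (map2 gen bs cs))"
  using assms
proof (induction bs arbitrary: C)
  case Nil
  then show ?case by (simp add: inversion_number_def)
next
  case (Cons b bs)
  have card_bs: "length bs = card (C - {c})" if "c \<in> C" for c
    using card.remove[OF Cons.prems(1) that] Cons.prems(2) by simp
  have IH: "row_det bs (C - {c}) = (\<Sum>cs\<in>permutations_of_set (C - {c}).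
      qpow (inversion_number {..<length bs} (nth cs)) * prod_list (map2 gen bs cs))" if "c \<in> C" for c
    using Cons.prems(1) card_bs[OF that] by (intro Cons.IH) auto
  have "row_det (b # bs) C = (\<Sum>c\<in>C. \<Sum>cs\<in>permutations_of_set (C - {c}).
      qpow (pos_in C c + inversion_number {..<length bs} (nth cs)) * (gen b c * prod_list (map2 gen bs cs)))"
    by (simp add: IH sum_distrib_left qpow_left qpow_add)
  also have "\<dots> = (\<Sum>c\<in>C. \<Sum>cs\<in>(\<lambda>cs. c # cs) ` permutations_of_set (C - {c}).
      qpow (inversion_number {..<length (b # bs)} (nth cs)) * prod_list (map2 gen (b # bs) cs))"
  proof (rule sum.cong[OF refl])
    fix c assume c: "c \<in> C"
    have inv: "inversion_number {..<length (b # bs)} (nth (c # cs)) =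
        pos_in C c + inversion_number {..<length bs} (nth cs)"
      if "cs \<in> permutations_of_set (C - {c})" for cs
    proof -
      note cs = permutations_of_setD[OF that]
      have "length bs = length cs"
        using length_finite_permutations_of_set[OF that] card_bs[OF c] by simp
      \<comment> \<open>The recursion counts positions in \<open>C\<close>, the inversion lemma in
        \<open>C - {c}\<close>; they agree because \<open>c\<close> is not below itself.\<close>
      moreover have "pos_in (insert c (C - {c})) c = pos_in (C - {c}) c"
        by (rule pos_in_insert_above) simp
      ultimately show ?thesis
        using inversion_number_nth_Cons[of cs c] cs c by (simp add: insert_absorb)
    qed
    show "(\<Sum>cs\<in>permutations_of_set (C - {c}). qpow (pos_in C c + inversion_number {..<length bs} (nth cs)) *
          (gen b c * prod_list (map2 gen bs cs))) =
        (\<Sum>cs\<in>(\<lambda>cs. c # cs) ` permutations_of_set (C - {c}).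
          qpow (inversion_number {..<length (b # bs)} (nth cs)) * prod_list (map2 gen (b # bs) cs))"
      unfolding sum.reindex[OF inj_on_Cons1] o_def
      by (intro sum.cong refl) (simp only: inv list.map zip_Cons_Cons prod_list.Cons prod.case)
  qed
  also have "\<dots> = (\<Sum>cs\<in>(\<Union>c\<in>C. (\<lambda>cs. c # cs) ` permutations_of_set (C - {c})).
      qpow (inversion_number {..<length (b # bs)} (nth cs)) * prod_list (map2 gen (b # bs) cs))"
    using Cons.prems by (intro sum.UNION_disjoint[symmetric]) auto
  also have "(\<Union>c\<in>C. (\<lambda>cs. c # cs) ` permutations_of_set (C - {c})) = permutations_of_set C"
    using Cons.prems by (intro permutations_of_set_nonempty[symmetric]) auto
  finally show ?case .
qed

section \<open>Passage to the quotient algebra\<close>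

lemma qmat_class_cong:
  assumes "f \<in> elements" "g \<in> elements" "f \<cong>\<^sub>q g"
  shows "qmat_class q N f = qmat_class q N g"
proof -
  interpret F: ring "qmat_free N" by (rule ring_free_algebra)
  have g: "- g \<in> elements"
    using assms by (intro elements_ops)
  \<comment> \<open>The additive inverse of the ring structure is taken inside its carrier; for
    elements of the carrier it agrees with the type class operation.\<close>
  have "\<ominus>\<^bsub>qmat_free N\<^esub> g = - g"
    using assms g unfolding elements_def
    by (intro F.minus_equality) (simp_all add: free_algebra_ops)
  then have "f \<ominus>\<^bsub>qmat_free N\<^esub> g = f - g"
    by (simp add: a_minus_def free_algebra_ops)
  then show ?thesis
    using assms F.quotient_eq_iff_same_a_r_cos[OF ideal_qmat_ideal, of f g q]
    by (simp add: qcong_def qmat_class_def elements_def)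
qed

lemma qmat_class_closed: "f \<in> elements \<Longrightarrow> qmat_class q N f \<in> carrier (qmat_algebra q N)"
  unfolding elements_def by (rule ring_hom_closed[OF qmat_class_hom])

lemma qmat_class_mult:
  "f \<in> elements \<Longrightarrow> g \<in> elements \<Longrightarrow>
    qmat_class q N f \<otimes>\<^bsub>qmat_algebra q N\<^esub> qmat_class q N g = qmat_class q N (f * g)"
  unfolding elements_def by (simp add: ring_hom_mult[OF qmat_class_hom, symmetric] free_algebra_ops)

lemma qmat_class_smult:
  "f \<in> elements \<Longrightarrow> c \<odot>\<^bsub>qmat_algebra q N\<^esub> qmat_class q N f = qmat_class q N (free_scalar c * f)"
  unfolding qmat_algebra_simps(6) qmat_algebra_simps(2)[symmetric]
  by (rule qmat_class_mult[OF elements_scalar])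

lemma qmat_class_sum:
  assumes "\<And>x. x \<in> A \<Longrightarrow> f x \<in> elements"
  shows "(\<Oplus>\<^bsub>qmat_algebra q N\<^esub>x\<in>A. qmat_class q N (f x)) = qmat_class q N (sum f A)"
proof -
  interpret A: ring "qmat_algebra q N" by (rule ring_qmat_algebra)
  have zero: "qmat_class q N 0 = \<zero>\<^bsub>qmat_algebra q N\<^esub>"
    using ring_hom_zero[OF qmat_class_hom ring_free_algebra ring_qmat_algebra, of q N]
    by (simp add: free_algebra_ops)
  show ?thesis
    using assms
  \<comment> \<open>Over an infinite index set both sums are zero by convention.\<close>
  proof (induction A rule: infinite_finite_induct)
    case (insert x A)
    then have "f x \<in> elements" "sum f A \<in> elements"
      by (auto intro: elements_sum)
    moreover from this have "qmat_class q N (f x + sum f A) =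
        qmat_class q N (f x) \<oplus>\<^bsub>qmat_algebra q N\<^esub> qmat_class q N (sum f A)"
      unfolding elements_def using ring_hom_add[OF qmat_class_hom, of "f x" N "sum f A" q]
      by (simp add: free_algebra_ops)
    ultimately show ?case
      using insert by (simp add: qmat_class_closed Pi_def)
  qed (simp_all add: zero A.finsum_infinite)
qed

text \<open>The two claims are proved together, since multiplying one more class onto a product
  requires the product of the tail to lie in \<open>elements\<close>.\<close>

lemma qmat_class_prod_list:
  assumes "\<And>x. x \<in> set xs \<Longrightarrow> f x \<in> elements"
  shows "foldr (\<lambda>x y. x \<otimes>\<^bsub>qmat_algebra q N\<^esub> y) (map (\<lambda>x. qmat_class q N (f x)) xs) \<one>\<^bsub>qmat_algebra q N\<^esub> =
      qmat_class q N (prod_list (map f xs))"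
    and "prod_list (map f xs) \<in> elements"
proof -
  have "foldr (\<lambda>x y. x \<otimes>\<^bsub>qmat_algebra q N\<^esub> y) (map (\<lambda>x. qmat_class q N (f x)) xs) \<one>\<^bsub>qmat_algebra q N\<^esub> =
      qmat_class q N (prod_list (map f xs)) \<and> prod_list (map f xs) \<in> elements"
    using assms
  proof (induction xs)
    case Nil
    then show ?case
      using ring_hom_one[OF qmat_class_hom, of q N] by (simp add: free_algebra_ops elements_ops)
  qed (simp add: qmat_class_mult elements_ops)
  then show "foldr (\<lambda>x y. x \<otimes>\<^bsub>qmat_algebra q N\<^esub> y) (map (\<lambda>x. qmat_class q N (f x)) xs) \<one>\<^bsub>qmat_algebra q N\<^esub> =
      qmat_class q N (prod_list (map f xs))"
    and "prod_list (map f xs) \<in> elements" by auto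
qed

section \<open>Quantum minors as row determinants\<close>

text \<open>As \<open>cols\<close> is increasing, comparing columns amounts to comparing their
  positions, so a permutation and its list of columns have the same number of inversions.\<close>

lemma quantum_minor_eq_row_det:
  assumes "sorted_wrt (<) cols" "length rows = length cols"
    and "set rows \<subseteq> index_range" "set cols \<subseteq> index_range"
  shows "quantum_minor q N rows cols = qmat_class q N (row_det rows (set cols))"
proof -
  define s where "s = length rows"
  let ?P = "{\<sigma>. \<sigma> permutes {..<s}}"
  have dist: "distinct cols"
    using assms(1) by (simp add: strict_sorted_iff)
  have factor: "gen (rows ! k) (cols ! \<sigma> k) \<in> elements" if "\<sigma> permutes {..<s}" "k < s" for \<sigma> k
  proof -
    have "\<sigma> k < s"
      using permutes_in_image[OF that(1), of k] that(2) by simp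
    then show ?thesis
      using that(2) assms nth_mem[of k rows] nth_mem[of "\<sigma> k" cols]
      by (intro elements_gen) (auto simp: s_def)
  qed
  have "quantum_minor q N rows cols = (\<Oplus>\<^bsub>qmat_algebra q N\<^esub>\<sigma>\<in>?P.
      qmat_class q N (qpow (inversion_number {..<s} \<sigma>) *
        prod_list (map (\<lambda>k. gen (rows ! k) (cols ! \<sigma> k)) [0..<s])))"
  proof -
    interpret A: ring "qmat_algebra q N" by (rule ring_qmat_algebra)
    have "(- q) ^ inversion_number {..<s} \<sigma> \<odot>\<^bsub>qmat_algebra q N\<^esub>
        foldr (\<lambda>x y. x \<otimes>\<^bsub>qmat_algebra q N\<^esub> y) (map (\<lambda>k. qmat_gen q N (rows ! k) (cols ! \<sigma> k)) [0..<s])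
          \<one>\<^bsub>qmat_algebra q N\<^esub> =
      qmat_class q N (qpow (inversion_number {..<s} \<sigma>) *
        prod_list (map (\<lambda>k. gen (rows ! k) (cols ! \<sigma> k)) [0..<s]))"
      and "prod_list (map (\<lambda>k. gen (rows ! k) (cols ! \<sigma> k)) [0..<s]) \<in> elements"
      if "\<sigma> \<in> ?P" for \<sigma>
      using that qmat_class_prod_list[of "[0..<s]" "\<lambda>k. gen (rows ! k) (cols ! \<sigma> k)"] factor[of \<sigma>]
      by (simp_all add: qmat_gen_def qmat_class_smult qpow_def)
    then show ?thesis
      unfolding quantum_minor_def s_def[symmetric]
      by (intro A.finsum_cong') (auto intro!: qmat_class_closed elements_ops elements_qpow)
  qed
  also have "\<dots> = qmat_class q N (\<Sum>\<sigma>\<in>?P. qpow (inversion_number {..<s} \<sigma>) *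
        prod_list (map (\<lambda>k. gen (rows ! k) (cols ! \<sigma> k)) [0..<s]))"
    using factor by (intro qmat_class_sum elements_ops elements_qpow qmat_class_prod_list(2)) auto
  also have "(\<Sum>\<sigma>\<in>?P. qpow (inversion_number {..<s} \<sigma>) *
        prod_list (map (\<lambda>k. gen (rows ! k) (cols ! \<sigma> k)) [0..<s])) =
      (\<Sum>cs\<in>permutations_of_set (set cols).
        qpow (inversion_number {..<s} (nth cs)) * prod_list (map2 gen rows cs))"
  proof (subst sum.reindex_bij_betw[OF bij_betw_permute_list[OF dist], symmetric], rule sum.cong)
    fix \<sigma> assume "\<sigma> \<in> {\<sigma>. \<sigma> permutes {..<length cols}}"
    then have \<sigma>: "\<sigma> permutes {..<length cols}"
      using assms(2) by (simp add: s_def)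
    have lt: "\<sigma> k < length cols" if "k < s" for k
      using that permutes_in_image[OF \<sigma>, of k] assms(2) by (simp add: s_def)
    have less_iff: "cols ! i < cols ! j \<longleftrightarrow> i < j" if "i < length cols" "j < length cols" for i j
      using sorted_wrt_nth_less[OF assms(1)] that by (metis linorder_neqE_nat order_less_asym)
    have nth: "permute_list \<sigma> cols ! k = cols ! \<sigma> k" if "k < s" for k
      using that assms(2) by (intro permute_list_nth[OF \<sigma>]) (simp add: s_def)
    have "inversion_number {..<s} (nth (permute_list \<sigma> cols)) = inversion_number {..<s} \<sigma>"
      unfolding inversion_number_def
      by (intro arg_cong[of _ _ card] Collect_cong) (auto simp: nth less_iff lt)
    moreover have "map2 gen rows (permute_list \<sigma> cols) = map (\<lambda>k. gen (rows ! k) (cols ! \<sigma> k)) [0..<s]"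
      using assms(2) by (intro nth_equalityI) (auto simp: s_def nth)
    ultimately show "qpow (inversion_number {..<s} \<sigma>) *
        prod_list (map (\<lambda>k. gen (rows ! k) (cols ! \<sigma> k)) [0..<s]) =
      qpow (inversion_number {..<s} (nth (permute_list \<sigma> cols))) *
        prod_list (map2 gen rows (permute_list \<sigma> cols))"
      by simp
  qed (use assms in \<open>auto simp: s_def\<close>)
  also have "\<dots> = row_det rows (set cols)"
    unfolding s_def using assms dist by (intro row_det_permutations[symmetric]) (auto simp: distinct_card)
  finally show ?thesis .
qed

end

subsection \<open>Shuffles as column sets\<close>

text \<open>A permutation fixing 1 to \<open>r\<close> pointwise permutes the remaining values, and
  by injectivity the last block receives what the middle block leaves.\<close>

lemma fixing_shuffles_image:
  assumes "\<sigma> \<in> fixing_shuffles n r" "r \<le> n"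
  shows "\<sigma> ` {r+1..2*n} = {r+1..2*n}"
    and "\<sigma> ` {n+1..2*n} = {r+1..2*n} - \<sigma> ` {r+1..n}"
    and "card (\<sigma> ` {r+1..n}) = n - r"
proof -
  have \<sigma>: "\<sigma> permutes {1..2*n}" "\<And>k. k \<in> {1..r} \<Longrightarrow> \<sigma> k = k"
    using assms by (auto simp: fixing_shuffles_def)
  note inj = permutes_inj[OF \<sigma>(1)]
  have "\<sigma> ` {1..r} = {1..r}"
    using \<sigma>(2) by force
  moreover have "{r+1..2*n} = {1..2*n} - {1..r}"
    using assms(2) by auto
  ultimately show tail: "\<sigma> ` {r+1..2*n} = {r+1..2*n}"
    using image_set_diff[OF inj, of "{1..2*n}" "{1..r}"] permutes_image[OF \<sigma>(1)] by simp
  have "{n+1..2*n} = {r+1..2*n} - {r+1..n}"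
    using assms(2) by auto
  then show "\<sigma> ` {n+1..2*n} = {r+1..2*n} - \<sigma> ` {r+1..n}"
    using image_set_diff[OF inj, of "{r+1..2*n}" "{r+1..n}"] tail by simp
  show "card (\<sigma> ` {r+1..n}) = n - r"
    using card_image[OF inj_on_subset[OF inj]] by simp
qed

text \<open>Positions after \<open>r\<close> carry values above \<open>r\<close>, so the fixed block
  and the middle block join into one increasing block. Hence the columns of both minors form
  increasing lists.\<close>

lemma fixing_shuffles_mono:
  assumes "\<sigma> \<in> fixing_shuffles n r" "r \<le> n"
  shows "strict_mono_on {1..n} \<sigma>" "strict_mono_on {n+1..2*n} \<sigma>"
proof -
  have fix_r: "\<And>k. k \<in> {1..r} \<Longrightarrow> \<sigma> k = k" and mono: "strict_mono_on {r+1..n} \<sigma>"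
    using assms by (auto simp: fixing_shuffles_def)
  show "strict_mono_on {n+1..2*n} \<sigma>"
    using assms by (simp add: fixing_shuffles_def)
  show "strict_mono_on {1..n} \<sigma>"
  proof (rule strict_mono_onI)
    fix i j assume ij: "i \<in> {1..n}" "j \<in> {1..n}" "i < j"
    consider "j \<le> r" | "i \<le> r" "r < j" | "r < i" by linarith
    then show "\<sigma> i < \<sigma> j"
    proof cases
      case 1
      then show ?thesis using ij fix_r[of i] fix_r[of j] by simp
    next
      case 2
      then have "\<sigma> j \<in> {r+1..2*n}"
        using ij fixing_shuffles_image(1)[OF assms] by (force dest: equalityD1)
      then show ?thesis using 2 ij fix_r[of i] by simp
    next
      case 3
      then show ?thesis using ij by (intro strict_mono_onD[OF mono]) auto
    qed
  qed
qed

text \<open>No inversion lies inside an increasing block or starts at a fixed position, so each runs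
  from the middle block to the last. Applying \<open>\<sigma>\<close> to both entries turns pairs of
  positions into pairs of columns.\<close>

lemma inversion_number_fixing_shuffles:
  assumes "\<sigma> \<in> fixing_shuffles n r" "r \<le> n"
  shows "inversion_number {1..2*n} \<sigma> =
    inversions_between (\<sigma> ` {r+1..n}) ({r+1..2*n} - \<sigma> ` {r+1..n})"
proof -
  have "\<sigma> permutes {1..2*n}" and fix_r: "\<And>k. k \<in> {1..r} \<Longrightarrow> \<sigma> k = k"
    using assms by (auto simp: fixing_shuffles_def)
  then have inj: "inj \<sigma>" by (intro permutes_inj)
  let ?A = "{(i, j). i \<in> {1..2*n} \<and> j \<in> {1..2*n} \<and> i < j \<and> \<sigma> j < \<sigma> i}"
  let ?B = "{(i, j). i \<in> \<sigma> ` {r+1..n} \<and> j \<in> \<sigma> ` {n+1..2*n} \<and> j < i}"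
  have block: "i \<in> {r+1..n} \<and> j \<in> {n+1..2*n}"
    if "i \<in> {1..2*n}" "j \<in> {1..2*n}" "i < j" "\<sigma> j < \<sigma> i" for i j
  proof -
    have "\<not> j \<le> n"
      using that strict_mono_onD[OF fixing_shuffles_mono(1)[OF assms], of i j] by auto
    moreover have "\<not> n < i"
      using that strict_mono_onD[OF fixing_shuffles_mono(2)[OF assms], of i j] by auto
    moreover have "\<not> i \<le> r"
    proof
      assume "i \<le> r"
      moreover have "\<sigma> j \<in> {r+1..2*n}"
        using that assms(2) \<open>\<not> j \<le> n\<close> imageI[of j "{r+1..2*n}" \<sigma>]
        unfolding fixing_shuffles_image(1)[OF assms] by auto
      ultimately show False
        using that fix_r[of i] by auto
    qed
    ultimately show ?thesis using that by auto
  qed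
  have "card ?B = card (map_prod \<sigma> \<sigma> ` ?A)"
  proof (intro arg_cong[of _ _ card] equalityI subsetI)
    fix p assume "p \<in> ?B"
    then obtain i j where "p = (\<sigma> i, \<sigma> j)" "i \<in> {r+1..n}" "j \<in> {n+1..2*n}" "\<sigma> j < \<sigma> i" by auto
    then show "p \<in> map_prod \<sigma> \<sigma> ` ?A"
      by (intro image_eqI[of _ _ "(i, j)"]) auto
  next
    fix p assume "p \<in> map_prod \<sigma> \<sigma> ` ?A"
    then obtain i j where ij: "p = (\<sigma> i, \<sigma> j)" "i \<in> {1..2*n}" "j \<in> {1..2*n}" "i < j" "\<sigma> j < \<sigma> i" by auto
    then show "p \<in> ?B"
      using block[OF ij(2-)] by auto
  qed
  also have "\<dots> = card ?A"
    using inj by (intro card_image) (auto simp: inj_on_def dest: injD)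
  finally show ?thesis
    by (simp only: inversion_number_def inversions_between_def fixing_shuffles_image(2)[OF assms])
qed

lemma sorted_map_upt:
  fixes \<sigma> :: "nat \<Rightarrow> nat"
  assumes "strict_mono_on {m..<k} \<sigma>"
  shows "sorted_wrt (<) (map \<sigma> [m..<k])"
  unfolding sorted_wrt_map
  by (rule sorted_wrt_mono_rel[OF _ sorted_wrt_upt]) (auto intro: strict_mono_onD[OF assms])

text \<open>The values in order form the strictly sorted list of the image, and a finite set has
  only one such list.\<close>

lemma strict_mono_on_eq_if_image_eq:
  fixes \<sigma> \<tau> :: "nat \<Rightarrow> nat"
  assumes "strict_mono_on {m..<k} \<sigma>" "strict_mono_on {m..<k} \<tau>" "\<sigma> ` {m..<k} = \<tau> ` {m..<k}"
    and "i \<in> {m..<k}"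
  shows "\<sigma> i = \<tau> i"
proof -
  have "map \<sigma> [m..<k] = map \<tau> [m..<k]"
    using assms(1-3) by (intro strict_sorted_equal sorted_map_upt) auto
  then show ?thesis
    using assms(4) by (auto simp: list_eq_iff_nth_eq dest: spec[of _ "i - m"])
qed

text \<open>A shuffle is recovered from its values on the middle block: the last block takes the
  complement, and each of the two is listed increasingly. This turns sums over shuffles into Laplace
  sums over column sets.\<close>

lemma bij_betw_fixing_shuffles:
  assumes "r \<le> n"
  shows "bij_betw (\<lambda>\<sigma>. \<sigma> ` {r+1..n}) (fixing_shuffles n r) {I. I \<subseteq> {r+1..2*n} \<and> card I = n - r}"
  unfolding bij_betw_def
proof
  have ivl: "{r+1..n} = {r+1..<n+1}" "{n+1..2*n} = {n+1..<2*n+1}" by auto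
  show "inj_on (\<lambda>\<sigma>. \<sigma> ` {r+1..n}) (fixing_shuffles n r)"
  proof (rule inj_onI)
    fix \<sigma> \<tau> assume *: "\<sigma> \<in> fixing_shuffles n r" "\<tau> \<in> fixing_shuffles n r"
      and eq: "\<sigma> ` {r+1..n} = \<tau> ` {r+1..n}"
    have eq': "\<sigma> ` {n+1..2*n} = \<tau> ` {n+1..2*n}"
      using fixing_shuffles_image(2) * assms eq by simp
    show "\<sigma> = \<tau>"
    proof
      fix k
      consider "k \<in> {1..r}" | "k \<in> {r+1..n}" | "k \<in> {n+1..2*n}" | "k \<notin> {1..2*n}"
        by fastforce
      then show "\<sigma> k = \<tau> k"
      proof cases
        case 1
        then show ?thesis using * by (auto simp: fixing_shuffles_def)
      next
        case 2
        then show ?thesis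
          using * eq unfolding ivl fixing_shuffles_def
          by (intro strict_mono_on_eq_if_image_eq[of "r+1" "n+1" \<sigma> \<tau>]) auto
      next
        case 3
        then show ?thesis
          using * eq' unfolding ivl fixing_shuffles_def
          by (intro strict_mono_on_eq_if_image_eq[of "n+1" "2*n+1" \<sigma> \<tau>]) auto
      next
        case 4
        then show ?thesis
          using * permutes_not_in[of \<sigma> "{1..2*n}" k] permutes_not_in[of \<tau> "{1..2*n}" k]
          by (simp add: fixing_shuffles_def)
      qed
    qed
  qed
  show "(\<lambda>\<sigma>. \<sigma> ` {r+1..n}) ` fixing_shuffles n r = {I. I \<subseteq> {r+1..2*n} \<and> card I = n - r}"
  proof (intro equalityI subsetI)
    fix I assume "I \<in> (\<lambda>\<sigma>. \<sigma> ` {r+1..n}) ` fixing_shuffles n r"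
    then obtain \<sigma> where \<sigma>: "\<sigma> \<in> fixing_shuffles n r" "I = \<sigma> ` {r+1..n}" by blast
    have "\<sigma> ` {r+1..n} \<subseteq> \<sigma> ` {r+1..2*n}" by (intro image_mono) auto
    then show "I \<in> {I. I \<subseteq> {r+1..2*n} \<and> card I = n - r}"
      using fixing_shuffles_image[OF \<sigma>(1) assms] \<sigma>(2) by simp
  next
    fix I assume "I \<in> {I. I \<subseteq> {r+1..2*n} \<and> card I = n - r}"
    then have I: "I \<subseteq> {r+1..2*n}" "card I = n - r" by auto
    define J where "J = {r+1..2*n} - I"
    have fin: "finite I" "finite J"
      using I by (auto simp: J_def intro: finite_subset)
    have card_J: "card J = n"
      using I assms fin by (simp add: J_def card_Diff_subset)
    \<comment> \<open>One-line notation of the shuffle belonging to \<open>I\<close>: fixed values,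
      then \<open>I\<close>, then its complement. List positions start at 0, hence the
      \<open>k - 1\<close> in \<open>\<sigma>\<close>.\<close>
    define xs where "xs = map Suc [0..<r] @ sorted_list_of_set I @ sorted_list_of_set J"
    define \<sigma> where "\<sigma> k = (if k \<in> {1..2*n} then xs ! (k - 1) else k)" for k
    have len: "length xs = 2*n"
      using I card_J assms by (simp add: xs_def)
    have set_xs: "set xs = {1..2*n}"
      using I assms fin by (auto simp: xs_def J_def)
    have dist: "distinct xs"
      using len set_xs by (intro card_distinct) simp
    have "bij_betw (nth xs \<circ> (\<lambda>k. k - 1)) {1..2*n} {1..2*n}"
    proof (rule bij_betw_trans)
      show "bij_betw (\<lambda>k. k - 1) {1..2*n} {..<2*n}"
        by (rule bij_betw_byWitness[of _ Suc]) auto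
      show "bij_betw (nth xs) {..<2*n} {1..2*n}"
        by (rule bij_betw_nth) (simp_all add: dist len set_xs)
    qed
    then have "bij_betw \<sigma> {1..2*n} {1..2*n}"
      by (rule iffD1[OF bij_betw_cong, rotated]) (simp add: \<sigma>_def)
    then have perm: "\<sigma> permutes {1..2*n}"
      by (rule bij_imp_permutes) (auto simp: \<sigma>_def)
    have first: "\<sigma> k = k" if "k \<in> {1..r}" for k
      using that assms by (auto simp: \<sigma>_def xs_def nth_append)
    have second: "\<sigma> k = sorted_list_of_set I ! (k - r - 1)" "k - r - 1 < card I" if "k \<in> {r+1..n}" for k
      using that assms I fin by (auto simp: \<sigma>_def xs_def nth_append)
    have third: "\<sigma> k = sorted_list_of_set J ! (k - n - 1)" "k - n - 1 < card J" if "k \<in> {n+1..2*n}" for k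
      using that assms I fin card_J by (auto simp: \<sigma>_def xs_def nth_append)
    have "strict_mono_on {r+1..n} \<sigma>"
    proof (rule strict_mono_onI)
      fix i j assume "i \<in> {r+1..n}" "j \<in> {r+1..n}" "i < j"
      then show "\<sigma> i < \<sigma> j"
        using second[of i] second[of j] sorted_wrt_nth_less[OF strict_sorted_list_of_set[of I], of "i - r - 1" "j - r - 1"]
        by simp
    qed
    moreover have "strict_mono_on {n+1..2*n} \<sigma>"
    proof (rule strict_mono_onI)
      fix i j assume "i \<in> {n+1..2*n}" "j \<in> {n+1..2*n}" "i < j"
      then show "\<sigma> i < \<sigma> j"
        using third[of i] third[of j] sorted_wrt_nth_less[OF strict_sorted_list_of_set[of J], of "i - n - 1" "j - n - 1"]
        by simp
    qed
    ultimately have \<sigma>: "\<sigma> \<in> fixing_shuffles n r"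
      using perm first by (simp add: fixing_shuffles_def)
    have "\<sigma> ` {r+1..n} \<subseteq> I"
      using second fin nth_mem[of _ "sorted_list_of_set I"] by (auto simp del: nth_mem)
    then have "\<sigma> ` {r+1..n} = I"
      using fixing_shuffles_image(3)[OF \<sigma> assms] I fin by (intro card_subset_eq) auto
    then show "I \<in> (\<lambda>\<sigma>. \<sigma> ` {r+1..n}) ` fixing_shuffles n r"
      using \<sigma> by blast
  qed
qed

section \<open>The identity for sums over shuffles\<close>

theorem proposition2p5:
  fixes q :: complex and n r :: nat
  assumes "q \<noteq> 0" and "n \<ge> 1" and "r \<le> n"
  shows
    "(\<Oplus>\<^bsub>qmat_algebra q (2*n)\<^esub>\<sigma>\<in>fixing_shuffles n r.
        (-q) ^ inversion_number {1..2*n} \<sigma> \<odot>\<^bsub>qmat_algebra q (2*n)\<^esub>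
        (quantum_minor q (2*n) [n+1..<2*n+1] (map \<sigma> [1..<n+1])
           \<otimes>\<^bsub>qmat_algebra q (2*n)\<^esub>
         quantum_minor q (2*n) [1..<n+1] (map \<sigma> [n+1..<2*n+1])))
     = (-q) powi (int n ^ 2 - 2 * int n * int r) \<odot>\<^bsub>qmat_algebra q (2*n)\<^esub>
       (\<Oplus>\<^bsub>qmat_algebra q (2*n)\<^esub>\<sigma>\<in>fixing_shuffles n r.
          (-q) powi (int n ^ 2 - int (inversion_number {1..2*n} \<sigma>)) \<odot>\<^bsub>qmat_algebra q (2*n)\<^esub>
          (quantum_minor q (2*n) [1..<n+1] (map \<sigma> [n+1..<2*n+1])
             \<otimes>\<^bsub>qmat_algebra q (2*n)\<^esub>
           quantum_minor q (2*n) [n+1..<2*n+1] (map \<sigma> [1..<n+1])))"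
proof -
  define N where "N = 2 * n"
  interpret A: ring "qmat_algebra q N" by (rule ring_qmat_algebra)
  define E where "E = {r+1..2*n}"
  define S where "S = {I. I \<subseteq> E \<and> card I = n - r}"
  define lo_rows hi_rows where "lo_rows = [1..<n+1]" and "hi_rows = [n+1..<2*n+1]"
  have sets: "set lo_rows = {1..n}" "set hi_rows = {n+1..2*n}"
    and len: "length lo_rows = n" "length hi_rows = n"
    by (auto simp: lo_rows_def hi_rows_def simp del: upt_Suc)
  \<comment> \<open>\<open>I\<close> is the set of columns on the middle block; the minor with the
    larger rows also receives the fixed columns, the other minor the complement of \<open>I\<close>
    in \<open>E\<close>.\<close>
  define hi_det where "hi_det I = row_det q hi_rows ({1..r} \<union> I)" for I
  define lo_det where "lo_det I = row_det q lo_rows (E - I)" for I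
  have bij: "bij_betw (\<lambda>\<sigma>. \<sigma> ` {r+1..n}) (fixing_shuffles n r) S"
    unfolding S_def E_def by (rule bij_betw_fixing_shuffles[OF assms(3)])
  have S_image: "\<sigma> ` {r+1..n} \<in> S" if "\<sigma> \<in> fixing_shuffles n r" for \<sigma>
    by (rule bij_betw_apply[OF bij that])
  have in_range: "hi_det I \<in> elements N" "lo_det I \<in> elements N" if "I \<in> S" for I
    using that assms(3) unfolding hi_det_def lo_det_def
    by (auto intro!: elements_row_det simp: S_def E_def N_def sets index_range_def)
  have minors: "quantum_minor q N hi_rows (map \<sigma> lo_rows) = qmat_class q N (hi_det (\<sigma> ` {r+1..n}))"
    "quantum_minor q N lo_rows (map \<sigma> hi_rows) = qmat_class q N (lo_det (\<sigma> ` {r+1..n}))"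
    if \<sigma>: "\<sigma> \<in> fixing_shuffles n r" for \<sigma>
  proof -
    have perm: "\<sigma> permutes {1..2*n}" and fix_r: "\<And>k. k \<in> {1..r} \<Longrightarrow> \<sigma> k = k"
      using \<sigma> by (auto simp: fixing_shuffles_def)
    have "{1..<n+1} = {1..n}" "{n+1..<2*n+1} = {n+1..2*n}" by auto
    then have sorted: "sorted_wrt (<) (map \<sigma> lo_rows)" "sorted_wrt (<) (map \<sigma> hi_rows)"
      unfolding lo_rows_def hi_rows_def
      using fixing_shuffles_mono[OF \<sigma> assms(3)] by (auto intro!: sorted_map_upt simp del: upt_Suc)
    have "{1..n} = {1..r} \<union> {r+1..n}"
      using assms(3) by auto
    moreover have "\<sigma> ` {1..r} = {1..r}"
      using fix_r by force
    ultimately have lo_image: "\<sigma> ` {1..n} = {1..r} \<union> \<sigma> ` {r+1..n}"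
      by (simp add: image_Un)
    have image_subset: "\<sigma> ` A \<subseteq> {1..2*n}" if "A \<subseteq> {1..2*n}" for A
      using image_mono[OF that, of \<sigma>] permutes_image[OF perm] by simp
    have cols: "set (map \<sigma> lo_rows) \<subseteq> index_range N" "set (map \<sigma> hi_rows) \<subseteq> index_range N"
      using image_subset[of "{1..n}"] image_subset[of "{n+1..2*n}"]
      by (simp_all add: sets index_range_def N_def)
    have rows: "set lo_rows \<subseteq> index_range N" "set hi_rows \<subseteq> index_range N"
      by (auto simp: sets index_range_def N_def)
    have same_length: "length hi_rows = length (map \<sigma> lo_rows)" "length lo_rows = length (map \<sigma> hi_rows)"
      by (simp_all add: len)
    show "quantum_minor q N hi_rows (map \<sigma> lo_rows) = qmat_class q N (hi_det (\<sigma> ` {r+1..n}))"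
      using quantum_minor_eq_row_det[OF sorted(1) same_length(1) rows(2) cols(1)]
      unfolding hi_det_def set_map sets lo_image .
    show "quantum_minor q N lo_rows (map \<sigma> hi_rows) = qmat_class q N (lo_det (\<sigma> ` {r+1..n}))"
      using quantum_minor_eq_row_det[OF sorted(2) same_length(2) rows(1) cols(2)]
      unfolding lo_det_def E_def set_map sets fixing_shuffles_image(2)[OF \<sigma> assms(3)] .
  qed
  \<comment> \<open>\<open>L\<close> and \<open>R\<close> give representatives in the free algebra
    of the summands belonging to the shuffle with column set \<open>I\<close>.\<close>
  define L where "L I = qpow q (inversions_between I (E - I)) * (hi_det I * lo_det I)" for I
  define R where "R I = free_scalar ((-q) powi (int n ^ 2 - int (inversions_between I (E - I)))) * (lo_det I * hi_det I)" for I
  have LR_in: "L I \<in> elements N" "R I \<in> elements N" if "I \<in> S" for I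
    unfolding L_def R_def using in_range[OF that] by (auto intro!: elements_ops elements_qpow elements_scalar)
  have terms: "(-q) ^ inversion_number {1..2*n} \<sigma> \<odot>\<^bsub>qmat_algebra q N\<^esub>
        (quantum_minor q N hi_rows (map \<sigma> lo_rows) \<otimes>\<^bsub>qmat_algebra q N\<^esub> quantum_minor q N lo_rows (map \<sigma> hi_rows)) =
      qmat_class q N (L (\<sigma> ` {r+1..n}))"
    "(-q) powi (int n ^ 2 - int (inversion_number {1..2*n} \<sigma>)) \<odot>\<^bsub>qmat_algebra q N\<^esub>
        (quantum_minor q N lo_rows (map \<sigma> hi_rows) \<otimes>\<^bsub>qmat_algebra q N\<^esub> quantum_minor q N hi_rows (map \<sigma> lo_rows)) =
      qmat_class q N (R (\<sigma> ` {r+1..n}))"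
    if \<sigma>: "\<sigma> \<in> fixing_shuffles n r" for \<sigma>
    unfolding minors[OF \<sigma>] L_def R_def qpow_def E_def inversion_number_fixing_shuffles[OF \<sigma> assms(3)]
    using in_range[OF S_image[OF \<sigma>]]
    by (simp_all add: qmat_class_mult qmat_class_smult elements_ops)
  have "(\<Oplus>\<^bsub>qmat_algebra q N\<^esub>\<sigma>\<in>fixing_shuffles n r.
      (-q) ^ inversion_number {1..2*n} \<sigma> \<odot>\<^bsub>qmat_algebra q N\<^esub>
        (quantum_minor q N hi_rows (map \<sigma> lo_rows) \<otimes>\<^bsub>qmat_algebra q N\<^esub> quantum_minor q N lo_rows (map \<sigma> hi_rows))) =
    (\<Oplus>\<^bsub>qmat_algebra q N\<^esub>\<sigma>\<in>fixing_shuffles n r. qmat_class q N (L (\<sigma> ` {r+1..n})))"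
    by (intro A.finsum_cong' refl terms(1) Pi_I qmat_class_closed LR_in S_image)
  also have "\<dots> = qmat_class q N (\<Sum>\<sigma>\<in>fixing_shuffles n r. L (\<sigma> ` {r+1..n}))"
    by (intro qmat_class_sum LR_in S_image)
  also have "(\<Sum>\<sigma>\<in>fixing_shuffles n r. L (\<sigma> ` {r+1..n})) = (\<Sum>I\<in>S. L I)"
    by (rule sum.reindex_bij_betw[OF bij])
  finally have lhs: "(\<Oplus>\<^bsub>qmat_algebra q N\<^esub>\<sigma>\<in>fixing_shuffles n r.
      (-q) ^ inversion_number {1..2*n} \<sigma> \<odot>\<^bsub>qmat_algebra q N\<^esub>
        (quantum_minor q N hi_rows (map \<sigma> lo_rows) \<otimes>\<^bsub>qmat_algebra q N\<^esub> quantum_minor q N lo_rows (map \<sigma> hi_rows))) =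
    qmat_class q N (\<Sum>I\<in>S. L I)" .
  have "(\<Oplus>\<^bsub>qmat_algebra q N\<^esub>\<sigma>\<in>fixing_shuffles n r.
      (-q) powi (int n ^ 2 - int (inversion_number {1..2*n} \<sigma>)) \<odot>\<^bsub>qmat_algebra q N\<^esub>
        (quantum_minor q N lo_rows (map \<sigma> hi_rows) \<otimes>\<^bsub>qmat_algebra q N\<^esub> quantum_minor q N hi_rows (map \<sigma> lo_rows))) =
    (\<Oplus>\<^bsub>qmat_algebra q N\<^esub>\<sigma>\<in>fixing_shuffles n r. qmat_class q N (R (\<sigma> ` {r+1..n})))"
    by (intro A.finsum_cong' refl terms(2) Pi_I qmat_class_closed LR_in S_image)
  also have "\<dots> = qmat_class q N (\<Sum>\<sigma>\<in>fixing_shuffles n r. R (\<sigma> ` {r+1..n}))"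
    by (intro qmat_class_sum LR_in S_image)
  also have "(\<Sum>\<sigma>\<in>fixing_shuffles n r. R (\<sigma> ` {r+1..n})) = (\<Sum>I\<in>S. R I)"
    by (rule sum.reindex_bij_betw[OF bij])
  finally have rhs: "(\<Oplus>\<^bsub>qmat_algebra q N\<^esub>\<sigma>\<in>fixing_shuffles n r.
      (-q) powi (int n ^ 2 - int (inversion_number {1..2*n} \<sigma>)) \<odot>\<^bsub>qmat_algebra q N\<^esub>
        (quantum_minor q N lo_rows (map \<sigma> hi_rows) \<otimes>\<^bsub>qmat_algebra q N\<^esub> quantum_minor q N hi_rows (map \<sigma> lo_rows))) =
    qmat_class q N (\<Sum>I\<in>S. R I)" .
  have first_cols: "set [1..<r+1] = {1..r}"
    by auto
  \<comment> \<open>The exchange is applied with 1 to \<open>r\<close> as fixed columns and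
    \<open>m = n - r\<close>.\<close>
  have "qcong q N (\<Sum>I\<in>S. L I) (qpow q ((n - r) * length lo_rows) *
      (\<Sum>I\<in>S. qpow q (inversions_between (E - I) I) * (lo_det I * hi_det I)))"
    unfolding S_def L_def hi_det_def lo_det_def first_cols[symmetric]
  proof (rule laplace_sum_exchange)
    show "sorted_wrt (<) hi_rows" "sorted_wrt (<) [1..<r+1]"
      by (simp_all add: hi_rows_def del: upt_Suc)
    show "length hi_rows = length [1..<r+1] + (n - r)" "card E = length lo_rows + (n - r)"
      using assms(3) by (simp_all add: len E_def del: upt_Suc)
    show "set [1..<r+1] \<subseteq> index_range N" "set hi_rows \<subseteq> index_range N"
      "set lo_rows \<subseteq> index_range N" "E \<subseteq> index_range N"
      using assms(3) unfolding first_cols sets index_range_def N_def E_def by auto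
    show "t < b" if "b \<in> set hi_rows" "t \<in> set lo_rows" for b t
      using that unfolding sets by simp
    show "p < e" if "p \<in> set [1..<r+1]" "e \<in> E" for p e
      using that unfolding first_cols E_def by simp
  qed (rule assms(1))
  also have "qpow q ((n - r) * length lo_rows) *
      (\<Sum>I\<in>S. qpow q (inversions_between (E - I) I) * (lo_det I * hi_det I)) =
    free_scalar ((-q) powi (int n ^ 2 - 2 * int n * int r)) * (\<Sum>I\<in>S. R I)"
    unfolding sum_distrib_left
  proof (rule sum.cong[OF refl])
    fix I assume I: "I \<in> S"
    have fin: "finite E" by (simp add: E_def)
    have sub: "I \<subseteq> E" "card I = n - r" and "finite I"
      using I fin by (auto simp: S_def intro: finite_subset)
    moreover have "card (E - I) = n"
      using sub \<open>finite I\<close> assms(3) by (simp add: card_Diff_subset E_def)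
    ultimately have flip: "inversions_between I (E - I) + inversions_between (E - I) I = (n - r) * n"
      using fin by (subst inversions_between_flip) auto
    \<comment> \<open>The exchange yields the exponent n(n-r) plus the inversions of the opposite
      order, which by \<open>flip\<close> is 2n(n-r) minus the inversions of the shuffle. This is
      the sum of the two exponents on the right; integers are used because n^2 - 2nr can be
      negative.\<close>
    have "int ((n - r) * length lo_rows + inversions_between (E - I) I) =
        2 * (int ((n - r) * n)) - int (inversions_between I (E - I))"
      using arg_cong[OF flip, of int] unfolding len of_nat_add by linarith
    also have "int ((n - r) * n) = int n ^ 2 - int n * int r"
      using assms(3) by (simp add: of_nat_diff algebra_simps power2_eq_square)
    finally have exponent: "int ((n - r) * length lo_rows + inversions_between (E - I) I) =
        (int n ^ 2 - 2 * int n * int r) + (int n ^ 2 - int (inversions_between I (E - I)))"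
      by simp
    have "(- q) ^ ((n - r) * length lo_rows + inversions_between (E - I) I) =
        (-q) powi (int n ^ 2 - 2 * int n * int r) * (-q) powi (int n ^ 2 - int (inversions_between I (E - I)))"
      unfolding power_int_of_nat[symmetric] exponent using assms(1) by (intro power_int_add) simp
    then show "qpow q ((n - r) * length lo_rows) * (qpow q (inversions_between (E - I) I) * (lo_det I * hi_det I)) =
        free_scalar ((-q) powi (int n ^ 2 - 2 * int n * int r)) * R I"
      unfolding R_def qpow_add by (simp only: qpow_def free_scalar_mult)
  qed
  finally have "qcong q N (\<Sum>I\<in>S. L I)
      (free_scalar ((-q) powi (int n ^ 2 - 2 * int n * int r)) * (\<Sum>I\<in>S. R I))" .
  then have "qmat_class q N (\<Sum>I\<in>S. L I) =
      (-q) powi (int n ^ 2 - 2 * int n * int r) \<odot>\<^bsub>qmat_algebra q N\<^esub> qmat_class q N (\<Sum>I\<in>S. R I)"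
    using LR_in by (simp add: qmat_class_smult elements_sum qmat_class_cong elements_ops elements_scalar)
  from this[folded lhs rhs] show ?thesis
    unfolding N_def lo_rows_def hi_rows_def .
qed

end
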